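(* Let $n\in\mathbb N$, let $X_1,\ldots,X_n$ be independent centered real random variables with variances $\sigma_1^2,\ldots,\sigma_n^2$ and finite third absolute moments $\beta_j=\mathsf E|X_j|^3$, and suppose $\sigma^2:=\sum_{j=1}^n\sigma_j^2>0$. Let $S_n:=(X_1+\ldots+X_n)/\sigma$, $\varepsilon_n:=\sigma^{-3}\sum_{j=1}^n\beta_j$, $f_{S_n}(t):=\mathsf Ee^{itS_n}$, $\varphi(t):=\exp(-t^2/2)$ and $\delta_n(t):=|f_{S_n}(t)-\varphi(t)|$. Then for every $t\in\mathbb R$ $$|f_{S_n}(t)|\le\exp\left(\tfrac12\,b(t,2\varepsilon_n)\right),\qquad \delta_n(t)\le\varepsilon_n\varphi(t)\int_0^{|t|}\frac{s^2}2\exp\left(\frac{s^2}2\right)ds .$$ Moreover, with $A:=\dfrac{\varepsilon_n^{-1/3}}{6a}$, for every $t\in\mathbb R$ $$\delta_n(t)\le\begin{cases}\displaystyle\varepsilon_n\varphi(t)\int_0^{|t|}\frac{s^2}2\exp\left(\frac{s^2\varepsilon_n^{2/3}}2\right)ds, & |t|\le A,\\[3mm] \displaystyle\varepsilon_n\varphi(t)\left(\int_0^{A}\frac{s^2}2\exp\left(\frac{s^2\varepsilon_n^{2/3}}2\right)ds+\int_A^{|t|}\frac{s^2}{2l}\exp\left(2a\varepsilon_n s^3\right)ds\right), & |t|>A,\end{cases}$$ where $l:=\inf_{t\ge0}\exp\left(-t^2/2+2at^3\right)\approx0.624489$. The constant $a$ and the function $b$ are as defined in the context.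
   Context: Let $a:=\max_{x>0}\dfrac{\cos x-1+x^2/2}{x^3}\approx0.099162$ and let $M\approx3.995896$ be the point where this maximum is attained. For $\gamma>0$ and $t\in\mathbb R$ set $$b(t,\gamma):=\begin{cases}-t^2+2\gamma a|t|^3, & \gamma|t|<M,\\ -2\gamma^{-2}\left(1-\cos(\gamma t)\right), & M\le\gamma|t|\le2\pi,\\ 0, & \gamma|t|>2\pi.\end{cases}$$ *)

theory Defs
  imports "HOL-Probability.Probability"
begin

definition cos_quot :: "real \<Rightarrow> real" where
  "cos_quot x = (cos x - 1 + x\<^sup>2 / 2) / x ^ 3"

text \<open>The supremum over \<open>x > 0\<close> is a maximum (approximately 0.099162), attained only at
  \<open>argmax_pt\<close> (approximately 3.995896).\<close>

definition const_a :: real where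
  "const_a = (SUP x\<in>{0<..}. cos_quot x)"

definition argmax_pt :: real where
  "argmax_pt = (THE x. 0 < x \<and> cos_quot x = const_a)"

definition b_fun :: "real \<Rightarrow> real \<Rightarrow> real" where
  "b_fun t \<gamma> =
     (if \<gamma> * \<bar>t\<bar> < argmax_pt then - t\<^sup>2 + 2 * \<gamma> * const_a * \<bar>t\<bar> ^ 3
      else if \<gamma> * \<bar>t\<bar> \<le> 2 * pi then - 2 * (1 - cos (\<gamma> * t)) / \<gamma>\<^sup>2
      else 0)"

definition const_l :: real where
  "const_l = (INF t\<in>{0..}. exp (- t\<^sup>2 / 2 + 2 * const_a * t ^ 3))"

end

theory Submission
  imports Defs
begin

text \<open>For a single centered distribution, symmetrization bounds the squared modulus of the
  characteristic function by the expectation of \<open>cos (t * (X - Y))\<close>, and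
  \<open>E \<bar>X - Y\<bar> ^ 3 \<le> 4 * E \<bar>X\<bar> ^ 3\<close>. Any inequality \<open>cos u \<le> 1 - c * u\<^sup>2 + d * \<bar>u\<bar> ^ 3\<close> with
  \<open>d \<ge> 0\<close> therefore yields a bound that is multiplicative over independent summands. Taking the
  polynomial tangent to the cosine at \<open>\<theta> = 2 * \<epsilon> * \<bar>t\<bar>\<close> (or at \<open>argmax_pt\<close>, if \<open>\<theta>\<close> is smaller)
  produces the function \<open>b_fun\<close>.

  The closeness to the normal law comes from \<open>f t - \<phi> t = \<phi> t * \<integral>\<^sub>0\<^sup>t exp (s\<^sup>2 / 2) * (f' s + s * f s) ds\<close>.
  By the product rule \<open>f' + s * f\<close> is the sum over \<open>j\<close> of \<open>f\<^sub>j' + \<sigma>\<^sub>j\<^sup>2 * s * f\<^sub>j\<close> times the product of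
  the other characteristic functions. The first factor is at most \<open>\<beta>\<^sub>j * s\<^sup>2 / 2\<close>, and the second is
  controlled by the first part together with \<open>\<sigma>\<^sub>j ^ 3 \<le> \<beta>\<^sub>j\<close>.\<close>

subsection \<open>Cubic majorants of the cosine\<close>

lemma mult_cos_less_sin:
  fixes y :: real
  assumes "0 < y" "y < pi"
  shows "y * cos y < sin y"
proof -
  have "sin 0 - 0 * cos 0 < sin y - y * cos y"
  proof (rule DERIV_pos_imp_increasing_open[OF \<open>0 < y\<close>, of "\<lambda>y. sin y - y * cos y"])
    fix x assume "0 < x" "x < y"
    with assms have "0 < x * sin x" by (auto intro!: mult_pos_pos sin_gt_zero)
    moreover have "((\<lambda>y. sin y - y * cos y) has_real_derivative x * sin x) (at x)"
      by (auto intro!: derivative_eq_intros)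
    ultimately show "\<exists>z. ((\<lambda>y. sin y - y * cos y) has_real_derivative z) (at x) \<and> 0 < z" by blast
  qed (auto intro!: continuous_intros)
  then show ?thesis by simp
qed

text \<open>Numerator of the derivative of \<open>cos_quot\<close> after the common factor
  \<open>x^2\<close> is cancelled, so it carries the sign of that derivative for positive
  \<open>x\<close>.\<close>

definition cos_quot_num :: "real \<Rightarrow> real" where
  "cos_quot_num x = 3 - 3 * cos x - x * sin x - x\<^sup>2 / 2"

lemma DERIV_cos_quot:
  assumes "0 < x"
  shows "(cos_quot has_real_derivative cos_quot_num x / x ^ 4) (at x)"
proof -
  have "(cos_quot has_real_derivative
      ((- sin x + x) * x ^ 3 - (cos x - 1 + x\<^sup>2 / 2) * (3 * x\<^sup>2)) / (x ^ 3 * x ^ 3)) (at x)"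
    unfolding cos_quot_def using assms by (auto intro!: derivative_eq_intros)
  moreover have "((- sin x + x) * x ^ 3 - (cos x - 1 + x\<^sup>2 / 2) * (3 * x\<^sup>2)) / (x ^ 3 * x ^ 3)
      = cos_quot_num x / x ^ 4"
    using assms by (simp add: cos_quot_num_def divide_simps) (simp add: algebra_simps power_numeral_reduce)
  ultimately show ?thesis by simp
qed

text \<open>The half-angle form separates the signs: the bracket is positive on
  \<open>(0, 2 * pi)\<close> by \<open>mult_cos_less_sin\<close>, so \<open>cos (x / 2)\<close>
  alone decides, and it changes sign at \<open>pi\<close>.\<close>

lemma DERIV_cos_quot_num:
  "(cos_quot_num has_real_derivative 4 * cos (x / 2) * (sin (x / 2) - x / 2 * cos (x / 2))) (at x)"
proof -
  have "sin x = 2 * sin (x / 2) * cos (x / 2)" "cos x = 2 * (cos (x / 2))\<^sup>2 - 1"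
    using sin_double[of "x / 2"] cos_double_cos[of "x / 2"] by auto
  then have eq: "2 * sin x - x * cos x - x = 4 * cos (x / 2) * (sin (x / 2) - x / 2 * cos (x / 2))"
    by algebra
  show ?thesis
    unfolding eq[symmetric] cos_quot_num_def by (auto intro!: derivative_eq_intros simp: algebra_simps)
qed

lemma isCont_cos_quot_num: "isCont cos_quot_num x"
  by (rule DERIV_isCont[OF DERIV_cos_quot_num])

lemma cos_quot_num_pos:
  assumes "0 < x" "x \<le> pi"
  shows "0 < cos_quot_num x"
proof -
  have "cos_quot_num 0 < cos_quot_num x"
  proof (rule DERIV_pos_imp_increasing_open[OF \<open>0 < x\<close>])
    fix y assume y: "0 < y" "y < x"
    have "0 < 4 * cos (y / 2) * (sin (y / 2) - y / 2 * cos (y / 2))"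
      using mult_cos_less_sin[of "y / 2"] cos_gt_zero[of "y / 2"] y assms by simp
    then show "\<exists>z. (cos_quot_num has_real_derivative z) (at y) \<and> 0 < z"
      using DERIV_cos_quot_num by blast
  qed (auto intro: continuous_at_imp_continuous_on isCont_cos_quot_num)
  then show ?thesis by (simp add: cos_quot_num_def)
qed

lemma cos_quot_num_strict_antimono:
  assumes "pi \<le> x" "x < y" "y \<le> 2 * pi"
  shows "cos_quot_num y < cos_quot_num x"
proof (rule DERIV_neg_imp_decreasing_open[OF \<open>x < y\<close>])
  fix z assume z: "x < z" "z < y"
  have "cos (z / 2) < 0"
    using cos_gt_zero_pi[of "z / 2 - pi"] z assms by (simp add: cos_diff)
  moreover have "0 < sin (z / 2) - z / 2 * cos (z / 2)"
    using mult_cos_less_sin[of "z / 2"] z assms pi_gt_zero by simp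
  ultimately have "4 * cos (z / 2) * (sin (z / 2) - z / 2 * cos (z / 2)) < 0"
    by (simp add: mult_neg_pos)
  then show "\<exists>w. (cos_quot_num has_real_derivative w) (at z) \<and> w < 0"
    using DERIV_cos_quot_num by blast
qed (auto intro: continuous_at_imp_continuous_on isCont_cos_quot_num)

text \<open>Beyond \<open>2 * pi\<close> crude bounds are enough: the numerator is at most
  \<open>6 + x - x^2 / 2\<close>, which is negative for \<open>x > 6\<close>.\<close>

lemma cos_quot_num_neg:
  assumes "2 * pi \<le> x"
  shows "cos_quot_num x < 0"
proof -
  have x: "6 < x" using assms pi_gt3 by linarith
  have "x * (- sin x) \<le> x * 1"
    using x sin_ge_minus_one[of x] by (intro mult_left_mono) linarith+
  moreover have "6 * x < x\<^sup>2" using x by (simp add: power2_eq_square)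
  ultimately show ?thesis
    using x cos_ge_minus_one[of x] unfolding cos_quot_num_def by linarith
qed

text \<open>The numerator is positive up to \<open>pi\<close>, decreases strictly on
  \<open>[pi, 2 * pi]\<close> and is negative afterwards. It therefore has exactly one positive zero
  \<open>M\<close>, and \<open>cos_quot\<close> increases strictly before \<open>M\<close> and
  decreases strictly after it.\<close>

lemma cos_quot_maximizer:
  obtains M where "pi < M" "M < 2 * pi" "cos_quot_num M = 0"
    "\<And>x. 0 < x \<Longrightarrow> x \<noteq> M \<Longrightarrow> cos_quot x < cos_quot M"
proof -
  have "\<exists>M\<ge>pi. M \<le> 2 * pi \<and> cos_quot_num M = 0"
    using cos_quot_num_pos[of pi] cos_quot_num_neg[of "2 * pi"] isCont_cos_quot_num
    by (intro IVT2) auto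
  then obtain M where M: "pi \<le> M" "M \<le> 2 * pi" "cos_quot_num M = 0" by blast
  have M': "pi < M" "M < 2 * pi"
    using M cos_quot_num_pos[of pi] cos_quot_num_neg[of "2 * pi"]
    by (metis less_irrefl order_le_less pi_gt_zero)+
  have cont: "continuous_on {u..v} cos_quot" if "0 < u" for u v
    using that by (intro continuous_at_imp_continuous_on ballI DERIV_isCont[OF DERIV_cos_quot]) auto
  show ?thesis
  proof (rule that[OF M' M(3)])
    fix x :: real assume x: "0 < x" "x \<noteq> M"
    show "cos_quot x < cos_quot M"
    proof (cases "x < M")
      case True
      then show ?thesis
      proof (rule DERIV_pos_imp_increasing_open)
        fix y assume y: "x < y" "y < M"
        have "0 < cos_quot_num y"
          using cos_quot_num_pos[of y] cos_quot_num_strict_antimono[of y M] x y M M' by force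
        then show "\<exists>z. (cos_quot has_real_derivative z) (at y) \<and> 0 < z"
          using DERIV_cos_quot[of y] x y by (intro exI[of _ "cos_quot_num y / y ^ 4"]) auto
      qed (use cont x in auto)
    next
      case False
      with x have "M < x" by simp
      then show ?thesis
      proof (rule DERIV_neg_imp_decreasing_open)
        fix y assume y: "M < y" "y < x"
        have "cos_quot_num y < 0"
          using cos_quot_num_neg[of y] cos_quot_num_strict_antimono[of M y] y M M' by force
        then show "\<exists>z. (cos_quot has_real_derivative z) (at y) \<and> z < 0"
          using DERIV_cos_quot[of y] M' y pi_gt_zero
          by (intro exI[of _ "cos_quot_num y / y ^ 4"]) (auto simp: divide_neg_pos)
      qed (use cont M' pi_gt_zero in auto)
    qed
  qed
qed

text \<open>Since the maximum is attained and strict, the supremum is the value at \<open>M\<close>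
  and the definite description in \<open>argmax_pt\<close> singles out \<open>M\<close>.\<close>

lemma shows argmax_pt_gt_pi: "pi < argmax_pt"
    and argmax_pt_less: "argmax_pt < 2 * pi"
    and cos_quot_num_argmax_pt: "cos_quot_num argmax_pt = 0"
    and const_a_eq: "const_a = cos_quot argmax_pt"
    and cos_quot_le: "\<And>x. 0 < x \<Longrightarrow> cos_quot x \<le> const_a"
proof -
  obtain M where M: "pi < M" "M < 2 * pi" "cos_quot_num M = 0"
    and max: "\<And>x. 0 < x \<Longrightarrow> x \<noteq> M \<Longrightarrow> cos_quot x < cos_quot M"
    using cos_quot_maximizer by blast
  have "0 < M" using M(1) pi_gt_zero by linarith
  have le: "cos_quot x \<le> cos_quot M" if "0 < x" for x
    using max[OF that] by fastforce
  have a: "const_a = cos_quot M"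
    unfolding const_a_def using \<open>0 < M\<close> le by (intro cSup_eq_maximum) auto
  have "argmax_pt = M"
    unfolding argmax_pt_def a using \<open>0 < M\<close> max by (intro the_equality) (auto, force)
  then show "pi < argmax_pt" "argmax_pt < 2 * pi" "cos_quot_num argmax_pt = 0"
    "const_a = cos_quot argmax_pt" "\<And>x. 0 < x \<Longrightarrow> cos_quot x \<le> const_a"
    using M a le by auto
qed

lemma cos_le_const_a: "cos u \<le> 1 - u\<^sup>2 / 2 + const_a * \<bar>u\<bar> ^ 3"
proof (cases "u = 0")
  case False
  then have "cos_quot \<bar>u\<bar> \<le> const_a" by (intro cos_quot_le) auto
  with False show ?thesis by (simp add: cos_quot_def divide_simps)
qed auto

lemma const_a_pos: "0 < const_a"
proof -
  have "3 * 3 < pi * pi" using pi_gt3 by (intro mult_strict_mono) auto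
  then have "0 < cos_quot pi" by (simp add: cos_quot_def power2_eq_square)
  then show ?thesis using cos_quot_le[of pi] by auto
qed

text \<open>Writing \<open>h x = (1 - cos x) / x\<^sup>2\<close>, the number \<open>const_a\<close> is the smallest slope of a descending
  line through the point \<open>(0, 1/2)\<close> that stays below the graph of \<open>h\<close>, and \<open>argmax_pt\<close> is the
  point where this line touches the graph.\<close>

definition cos_ratio :: "real \<Rightarrow> real" where
  "cos_ratio x = (1 - cos x) / x\<^sup>2"

definition cos_ratio' :: "real \<Rightarrow> real" where
  "cos_ratio' x = (x * sin x - 2 * (1 - cos x)) / x ^ 3"

definition cos_ratio'' :: "real \<Rightarrow> real" where
  "cos_ratio'' x = (x\<^sup>2 * cos x - 4 * x * sin x + 6 - 6 * cos x) / x ^ 4"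

lemma DERIV_cos_ratio:
  assumes "0 < x"
  shows "(cos_ratio has_real_derivative cos_ratio' x) (at x)"
proof -
  have "(cos_ratio has_real_derivative (sin x * x\<^sup>2 - (1 - cos x) * (2 * x)) / (x\<^sup>2 * x\<^sup>2)) (at x)"
    unfolding cos_ratio_def using assms by (auto intro!: derivative_eq_intros)
  moreover have "(sin x * x\<^sup>2 - (1 - cos x) * (2 * x)) / (x\<^sup>2 * x\<^sup>2) = cos_ratio' x"
    using assms by (simp add: cos_ratio'_def divide_simps) (simp add: algebra_simps power_numeral_reduce)
  ultimately show ?thesis by simp
qed

lemma DERIV_cos_ratio':
  assumes "0 < x"
  shows "(cos_ratio' has_real_derivative cos_ratio'' x) (at x)"
proof -
  have "(cos_ratio' has_real_derivative
     ((x * cos x - sin x) * x ^ 3 - (x * sin x - 2 * (1 - cos x)) * (3 * x\<^sup>2)) / (x ^ 3 * x ^ 3)) (at x)"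
    unfolding cos_ratio'_def using assms by (auto intro!: derivative_eq_intros)
  moreover have "((x * cos x - sin x) * x ^ 3 - (x * sin x - 2 * (1 - cos x)) * (3 * x\<^sup>2)) / (x ^ 3 * x ^ 3)
     = cos_ratio'' x"
    using assms by (simp add: cos_ratio''_def divide_simps) (simp add: algebra_simps power_numeral_reduce)
  ultimately show ?thesis by simp
qed

text \<open>This gives convexity of \<open>cos_ratio\<close> on \<open>[pi, 2 * pi]\<close>. Up to
  \<open>3 * pi / 2\<close> the numerator \<open>N\<close> is increasing, because \<open>N'\<close>
  starts at \<open>2 * pi\<close> and has derivative \<open>- x^2 * cos x \<ge> 0\<close>. After
  that all contributions to \<open>N\<close> are nonnegative by the signs of sine and
  cosine.\<close>

lemma cos_ratio''_nonneg:
  assumes "pi \<le> x" "x \<le> 2 * pi"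
  shows "0 \<le> cos_ratio'' x"
proof -
  define N where "N = (\<lambda>x::real. x\<^sup>2 * cos x - 4 * x * sin x + 6 - 6 * cos x)"
  define N' where "N' = (\<lambda>x::real. 2 * sin x - 2 * x * cos x - x\<^sup>2 * sin x)"
  have dN: "(N has_real_derivative N' x) (at x)" for x
    unfolding N_def N'_def by (auto intro!: derivative_eq_intros simp: algebra_simps)
  have dN': "(N' has_real_derivative - (x\<^sup>2 * cos x)) (at x)" for x
    unfolding N'_def by (auto intro!: derivative_eq_intros simp: algebra_simps power2_eq_square)
  have cos_neg: "cos y \<le> 0" if "pi \<le> y" "y \<le> 3 * pi / 2" for y
    using cos_ge_zero[of "y - pi"] that pi_gt_zero by (simp add: cos_diff)
  have cos_pos: "0 \<le> cos y" if "3 * pi / 2 \<le> y" "y \<le> 2 * pi" for y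
    using cos_ge_zero[of "y - 2 * pi"] that pi_gt_zero by (simp add: cos_diff)
  have sin_neg: "sin y \<le> 0" if "pi \<le> y" "y \<le> 2 * pi" for y
    using sin_ge_zero[of "y - pi"] that by (simp add: sin_diff)
  have "0 \<le> N x"
  proof (cases "x \<le> 3 * pi / 2")
    case True
    have "0 \<le> N' y" if y: "pi \<le> y" "y \<le> x" for y
    proof -
      have "N' pi \<le> N' y"
      proof (rule DERIV_nonneg_imp_nondecreasing[OF y(1)])
        fix z assume "pi \<le> z" "z \<le> y"
        then have "cos z \<le> 0" using y True by (intro cos_neg) auto
        then have "0 \<le> - (z\<^sup>2 * cos z)" by (simp add: mult_nonneg_nonpos)
        then show "\<exists>w. (N' has_real_derivative w) (at z) \<and> 0 \<le> w" using dN' by blast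
      qed
      moreover have "0 < N' pi" using pi_gt_zero by (simp add: N'_def)
      ultimately show ?thesis by linarith
    qed
    then have "N pi \<le> N x"
      using dN by (intro DERIV_nonneg_imp_nondecreasing[OF assms(1)]) blast
    \<comment> \<open>The starting value is \<open>N pi = 12 - pi^2\<close>, and
      \<open>3.2^2 < 12\<close>.\<close>
    moreover have "pi * pi \<le> 3.2 * 3.2"
      using pi_approx by (intro mult_mono) auto
    ultimately show ?thesis by (simp add: N_def power2_eq_square)
  next
    case False
    have "0 \<le> x\<^sup>2 * cos x" using cos_pos[of x] False assms by (intro mult_nonneg_nonneg) auto
    moreover have "0 \<le> x * (- sin x)"
      using sin_neg[of x] False assms pi_gt_zero by (intro mult_nonneg_nonneg) auto
    ultimately show ?thesis unfolding N_def using cos_le_one[of x] by linarith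
  qed
  then show ?thesis by (simp add: cos_ratio''_def N_def)
qed

lemma cos_ratio_above_tangent:
  assumes "pi \<le> x" "x \<le> 2 * pi" "pi \<le> y" "y \<le> 2 * pi"
  shows "cos_ratio y + cos_ratio' y * (x - y) \<le> cos_ratio x"
proof -
  have "cos_ratio' y * (x - y) \<le> cos_ratio x - cos_ratio y"
  proof (rule f''_imp_f'[where C = "{pi..2 * pi}" and f'' = cos_ratio''])
    fix z assume "z \<in> {pi..2 * pi}"
    then have "0 < z" by (metis atLeastAtMost_iff less_le_trans pi_gt_zero)
    then show "(cos_ratio has_real_derivative cos_ratio' z) (at z)"
      "(cos_ratio' has_real_derivative cos_ratio'' z) (at z)"
      by (rule DERIV_cos_ratio DERIV_cos_ratio')+
  qed (use assms cos_ratio''_nonneg in auto)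
  then show ?thesis by simp
qed

text \<open>The line \<open>c - d * x\<close> is the tangent of \<open>cos_ratio\<close> at
  \<theta>; multiplying by \<open>u^2\<close> turns a line below \<open>cos_ratio\<close> into a
  cubic majorant of the cosine. Convexity keeps the tangent below the graph only on
  \<open>[pi, 2 * pi]\<close>, so the two outer ranges need the bounds
  \<open>d \<le> const_a\<close> and \<open>0 \<le> d\<close>.\<close>

lemma cos_le_tangent:
  assumes "argmax_pt \<le> \<theta>" "\<theta> \<le> 2 * pi"
  obtains c d where "0 \<le> d" "\<And>u. cos u \<le> 1 - c * u\<^sup>2 + d * \<bar>u\<bar> ^ 3" "c - d * \<theta> = (1 - cos \<theta>) / \<theta>\<^sup>2"
proof -
  define M where "M = argmax_pt"
  note M = argmax_pt_gt_pi[folded M_def] argmax_pt_less[folded M_def]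
  have "0 < M" using M pi_gt_zero by linarith
  have \<theta>: "M \<le> \<theta>" "pi \<le> \<theta>" "\<theta> \<le> 2 * pi" using assms M by (auto simp: M_def)
  define d where "d = - cos_ratio' \<theta>"
  define c where "c = cos_ratio \<theta> + d * \<theta>"
  have ratio_2pi: "cos_ratio (2 * pi) = 0" by (simp add: cos_ratio_def)
  have ratio_nonneg: "0 \<le> cos_ratio x" for x by (simp add: cos_ratio_def)
  have ratio_M: "cos_ratio M = 1 / 2 - const_a * M"
    using \<open>0 < M\<close> const_a_eq
    by (simp add: cos_ratio_def cos_quot_def flip: M_def) (simp add: field_simps power_numeral_reduce)
  \<comment> \<open>The zero of \<open>cos_quot_num\<close> at \<open>M\<close> enters here: the
    line \<open>1 / 2 - const_a * x\<close> not only meets the graph at \<open>M\<close> but is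
    tangent to it.\<close>
  have ratio'_M: "cos_ratio' M = - const_a"
    using \<open>0 < M\<close> const_a_eq cos_quot_num_argmax_pt
    by (simp add: cos_ratio'_def cos_quot_def cos_quot_num_def flip: M_def) (simp add: divide_simps)
  have d_nonneg: "0 \<le> d"
  proof (cases "\<theta> = 2 * pi")
    case False
    have "cos_ratio \<theta> \<le> d * (2 * pi - \<theta>)"
      using cos_ratio_above_tangent[of "2 * pi" \<theta>] \<theta> by (simp add: ratio_2pi d_def)
    then have "0 \<le> d * (2 * pi - \<theta>)" using ratio_nonneg[of \<theta>] by linarith
    with False \<theta> show ?thesis by (simp add: zero_le_mult_iff)
  qed (simp add: d_def cos_ratio'_def)
  \<comment> \<open>Slopes of a convex function increase. This is obtained by adding the tangent
    inequalities at \<theta> and at \<open>M\<close>, each evaluated at the other point.\<close>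
  have d_le: "d \<le> const_a"
  proof (cases "\<theta> = M")
    case False
    have "cos_ratio \<theta> + d * (\<theta> - M) \<le> cos_ratio M"
      using cos_ratio_above_tangent[of M \<theta>] \<theta> M by (simp add: d_def algebra_simps)
    moreover have "cos_ratio M - const_a * (\<theta> - M) \<le> cos_ratio \<theta>"
      using cos_ratio_above_tangent[of \<theta> M] \<theta> M by (simp add: ratio'_M)
    ultimately have "d * (\<theta> - M) \<le> const_a * (\<theta> - M)" by linarith
    with False \<theta> show ?thesis by simp
  qed (simp add: d_def ratio'_M)
  have tangent: "c - d * x \<le> cos_ratio x" if "0 < x" for x
  proof -
    consider "x \<le> M" | "M \<le> x" "x \<le> 2 * pi" | "2 * pi \<le> x" by linarith
    then show ?thesis
    proof cases
      case 1
      \<comment> \<open>The tangent is below the graph at \<open>M\<close> and less steep than the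
        line \<open>1 / 2 - const_a * x\<close> through that graph point, so to the left of
        \<open>M\<close> it stays below that line, which is below \<open>cos_ratio\<close> by
        maximality of \<open>const_a\<close>.\<close>
      have "c - d * M \<le> cos_ratio M"
        using cos_ratio_above_tangent[of M \<theta>] \<theta> M by (simp add: c_def d_def algebra_simps)
      moreover have "d * (M - x) \<le> const_a * (M - x)" using d_le 1 by (intro mult_right_mono) auto
      moreover have "1 / 2 - const_a * x \<le> cos_ratio x"
        using cos_quot_le[OF that] that
        by (simp add: cos_ratio_def cos_quot_def divide_simps) (simp add: algebra_simps power_numeral_reduce)
      ultimately show ?thesis by (simp add: ratio_M algebra_simps)
    next
      case 2
      then show ?thesis
        using cos_ratio_above_tangent[of x \<theta>] \<theta> M by (simp add: c_def d_def algebra_simps)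
    next
      case 3
      \<comment> \<open>The tangent is nonpositive at \<open>2 * pi\<close>, where
        \<open>cos_ratio\<close> vanishes, and does not increase from there, whereas
        \<open>cos_ratio\<close> is never negative.\<close>
      have "c - d * (2 * pi) \<le> 0"
        using cos_ratio_above_tangent[of "2 * pi" \<theta>] \<theta> M
        unfolding ratio_2pi c_def d_def by (simp add: algebra_simps)
      moreover have "d * (2 * pi) \<le> d * x" using d_nonneg 3 by (rule mult_left_mono[rotated])
      ultimately show ?thesis using ratio_nonneg[of x] by linarith
    qed
  qed
  have "cos u \<le> 1 - c * u\<^sup>2 + d * \<bar>u\<bar> ^ 3" for u
  proof (cases "u = 0")
    case False
    then have "(c - d * \<bar>u\<bar>) * u\<^sup>2 \<le> 1 - cos u"
      using tangent[of "\<bar>u\<bar>"] by (simp add: cos_ratio_def pos_le_divide_eq)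
    moreover have "\<bar>u\<bar> * u\<^sup>2 = \<bar>u\<bar> ^ 3" by (simp add: power_numeral_reduce abs_mult_self_eq)
    ultimately show ?thesis by (simp add: algebra_simps)
  qed auto
  moreover have "c - d * \<theta> = (1 - cos \<theta>) / \<theta>\<^sup>2" by (simp add: c_def cos_ratio_def)
  ultimately show ?thesis using d_nonneg that by blast
qed

subsection \<open>A single centered distribution\<close>

lemma DERIV_mult_abs: "((\<lambda>w::real. w * \<bar>w\<bar>) has_real_derivative 2 * \<bar>w\<bar>) (at w)"
proof (cases "w = 0")
  case True
  have "((\<lambda>h::real. \<bar>h\<bar>) \<longlongrightarrow> 0) (at 0)" by (auto intro!: tendsto_eq_intros)
  then have "((\<lambda>h::real. ((0 + h) * \<bar>0 + h\<bar> - 0 * \<bar>0\<bar>) / h) \<longlongrightarrow> 0) (at 0)"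
    by (rule Lim_transform_eventually) (auto simp: eventually_at_filter)
  then show ?thesis using True by (simp add: DERIV_def)
next
  case False
  then consider "0 < w" | "w < 0" by linarith
  then show ?thesis
  proof cases
    case 1
    have "((\<lambda>w. w * w) has_real_derivative 2 * \<bar>w\<bar>) (at w)"
      using 1 by (auto intro!: derivative_eq_intros)
    then show ?thesis
      by (rule has_field_derivative_transform_within_open[where S = "{0<..}"]) (use 1 in auto)
  next
    case 2
    have "((\<lambda>w. w * - w) has_real_derivative 2 * \<bar>w\<bar>) (at w)"
      using 2 by (auto intro!: derivative_eq_intros)
    then show ?thesis
      by (rule has_field_derivative_transform_within_open[where S = "{..<0}"]) (use 2 in auto)
  qed
qed

text \<open>The function \<open>v \<mapsto> g v + (x + y - v) * g' v\<close> with \<open>g v = iexp (t * v)\<close> has derivative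
  \<open>(x + y - v) * g'' v\<close> and takes the values \<open>g x + y * g' x\<close> and \<open>g y + x * g' y\<close> at \<open>x\<close> and \<open>y\<close>.\<close>

lemma iexp_trapezoid_bound:
  "cmod ((iexp (t * x) - iexp (t * y)) - \<i> * t * (x * iexp (t * y) - y * iexp (t * x)))
    \<le> t\<^sup>2 * \<bar>x * \<bar>x\<bar> - y * \<bar>y\<bar>\<bar> / 2"
proof -
  have *: "cmod ((iexp (t * x) - iexp (t * y)) - \<i> * t * (x * iexp (t * y) - y * iexp (t * x)))
      \<le> t\<^sup>2 * (x * \<bar>x\<bar> - y * \<bar>y\<bar>) / 2" if "y < x" for x y
  proof -
    define F where "F = (\<lambda>v. iexp (t * v) + of_real (x + y - v) * (\<i> * t * iexp (t * v)))"
    \<comment> \<open>An antiderivative of \<open>t^2 * \<bar>x + y - v\<bar>\<close>, the norm of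
      the derivative of \<open>F\<close>; its increment from \<open>y\<close> to \<open>x\<close> is
      the claimed bound.\<close>
    define G where "G = (\<lambda>v. - (t\<^sup>2 / 2) * ((x + y - v) * \<bar>x + y - v\<bar>))"
    have dF: "(F has_vector_derivative of_real (x + y - v) * (\<i> * t * (\<i> * t * iexp (t * v)))) (at v)" for v
    proof -
      have "((\<lambda>z. exp (\<i> * (t * z)) + (x + y - z) * (\<i> * t * exp (\<i> * (t * z)))) has_field_derivative
        of_real (x + y - v) * (\<i> * t * (\<i> * t * iexp (t * v)))) (at (complex_of_real v))"
        by (auto intro!: derivative_eq_intros simp: algebra_simps)
      from has_vector_derivative_real_field[OF this] show ?thesis
        by (simp add: F_def)
    qed
    have dG: "(G has_vector_derivative t\<^sup>2 * \<bar>x + y - v\<bar>) (at v)" for v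
    proof -
      have "((\<lambda>v. (x + y - v) * \<bar>x + y - v\<bar>) has_real_derivative 2 * \<bar>x + y - v\<bar> * (- 1)) (at v)"
        by (rule DERIV_chain2[OF DERIV_mult_abs]) (auto intro!: derivative_eq_intros)
      from DERIV_cmult[OF this, of "- (t\<^sup>2 / 2)"] show ?thesis
        by (simp add: G_def has_real_derivative_iff_has_vector_derivative)
    qed
    have "cmod (F x - F y) \<le> G x - G y"
    proof (rule differentiable_bound_general[OF that _ _ dF dG])
      show "continuous_on {y..x} F" "continuous_on {y..x} G"
        using dF dG by (auto intro!: continuous_at_imp_continuous_on has_vector_derivative_continuous)
    qed (simp add: norm_mult power2_eq_square abs_mult mult.commute del: of_real_add of_real_diff)
    then show ?thesis
      by (simp add: F_def G_def algebra_simps)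
  qed
  consider "y < x" | "x = y" | "x < y" by linarith
  then show ?thesis
  proof cases
    case 1
    from *[OF 1] show ?thesis by (rule order_trans) (simp add: mult_left_mono)
  next
    case 3
    have "cmod ((iexp (t * x) - iexp (t * y)) - \<i> * t * (x * iexp (t * y) - y * iexp (t * x)))
      = cmod ((iexp (t * y) - iexp (t * x)) - \<i> * t * (y * iexp (t * x) - x * iexp (t * y)))"
      by (subst norm_minus_commute) (simp add: algebra_simps)
    also have "\<dots> \<le> t\<^sup>2 * \<bar>x * \<bar>x\<bar> - y * \<bar>y\<bar>\<bar> / 2"
      using *[OF 3] by (rule order_trans) (simp add: mult_left_mono)
    finally show ?thesis .
  qed simp
qed

text \<open>Since \<open>w * \<bar>w\<bar>\<close> is increasing, both differences have the same
  sign and the product can be expanded without absolute values. Each mixed term then contains a bare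
  factor \<open>x\<close> or \<open>y\<close>, so it vanishes on integration against a centered
  law.\<close>

lemma abs_diff_mult_abs_diff:
  fixes x y :: real
  shows "\<bar>x - y\<bar> * \<bar>x * \<bar>x\<bar> - y * \<bar>y\<bar>\<bar> = \<bar>x\<bar> ^ 3 + \<bar>y\<bar> ^ 3 - x * (y * \<bar>y\<bar>) - y * (x * \<bar>x\<bar>)"
proof -
  have "0 \<le> (x - y) * (x * \<bar>x\<bar> - y * \<bar>y\<bar>)"
  proof (cases "x \<le> y")
    case True
    have "x * \<bar>x\<bar> \<le> y * \<bar>y\<bar>"
      by (rule DERIV_nonneg_imp_nondecreasing[OF True]) (metis DERIV_mult_abs abs_ge_zero mult_nonneg_nonneg zero_le_numeral)
    with True show ?thesis by (simp add: mult_nonpos_nonpos)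
  next
    case False
    then have "y \<le> x" by simp
    have "y * \<bar>y\<bar> \<le> x * \<bar>x\<bar>"
      by (rule DERIV_nonneg_imp_nondecreasing[OF \<open>y \<le> x\<close>]) (metis DERIV_mult_abs abs_ge_zero mult_nonneg_nonneg zero_le_numeral)
    with \<open>y \<le> x\<close> show ?thesis by simp
  qed
  moreover have "x * (x * \<bar>x\<bar>) = \<bar>x\<bar> ^ 3" for x :: real
    by (simp add: power_numeral_reduce abs_mult_self_eq flip: mult.assoc)
  ultimately show ?thesis by (simp add: algebra_simps flip: abs_mult)
qed

lemma (in prob_space) has_bochner_integral_const_prob:
  "has_bochner_integral M (\<lambda>_. c :: 'b :: {banach, second_countable_topology}) c"
  using has_bochner_integral_integrable[OF integrable_const[of c]] by (simp add: prob_space)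

text \<open>Independent copies are modelled by integrating twice over \<open>M\<close>, first in
  \<open>y\<close> and then in \<open>x\<close>. The values \<open>F1\<close>, \<open>F2\<close>,
  \<open>G1\<close>, \<open>G2\<close> are explicit so that each integral can be supplied as a
  \<open>has_bochner_integral\<close> fact.\<close>

lemma iterated_integral_mono:
  fixes F G :: "real \<Rightarrow> real \<Rightarrow> real"
  assumes "\<And>x. has_bochner_integral M (F x) (F1 x)" "has_bochner_integral M F1 F2"
    and "\<And>x. has_bochner_integral M (G x) (G1 x)" "has_bochner_integral M G1 G2"
    and "\<And>x y. F x y \<le> G x y"
  shows "F2 \<le> G2"
proof -
  have "F1 x \<le> G1 x" for x
    using integral_mono[of M "F x" "G x"] assms
    by (auto simp: has_bochner_integral_iff)
  then show ?thesis
    using integral_mono[of M F1 G1] assms by (auto simp: has_bochner_integral_iff)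
qed

lemma iterated_integral_norm_bound:
  fixes F :: "real \<Rightarrow> real \<Rightarrow> complex" and G :: "real \<Rightarrow> real \<Rightarrow> real"
  assumes "\<And>x. has_bochner_integral M (F x) (F1 x)" "has_bochner_integral M F1 F2"
    and "\<And>x. has_bochner_integral M (G x) (G1 x)" "has_bochner_integral M G1 G2"
    and "\<And>x y. norm (F x y) \<le> G x y"
  shows "norm F2 \<le> G2"
proof -
  have "norm (F1 x) \<le> G1 x" for x
    using Bochner_Integration.integral_norm_bound_integral[of M "F x" "G x"] assms
    by (auto simp: has_bochner_integral_iff)
  then show ?thesis
    using Bochner_Integration.integral_norm_bound_integral[of M F1 G1] assms
    by (auto simp: has_bochner_integral_iff)
qed

lemma power_le_one_plus_cube:
  fixes x :: real
  assumes "0 \<le> x" "k \<le> 3"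
  shows "x ^ k \<le> 1 + x ^ 3"
proof (cases "x \<le> 1")
  case True
  with assms have "x ^ k \<le> 1" by (simp add: power_le_one)
  with assms show ?thesis by (smt (verit) zero_le_power)
next
  case False
  with assms have "x ^ k \<le> x ^ 3" by (intro power_increasing) auto
  then show ?thesis by simp
qed

text \<open>Only one of the three factors \<open>\<bar>x - y\<bar>\<close> is estimated, by
  \<open>\<bar>x\<bar> + \<bar>y\<bar>\<close>; the other two form a square that is expanded
  exactly. The subtracted terms again vanish for centered laws.\<close>

lemma abs_diff_cube_le:
  fixes x y :: real
  shows "\<bar>x - y\<bar> ^ 3 \<le> ((\<bar>x\<bar> ^ 3 + \<bar>y\<bar> ^ 3) + (x\<^sup>2 * \<bar>y\<bar> + \<bar>x\<bar> * y\<^sup>2)) - 2 * ((x * \<bar>x\<bar>) * y + x * (y * \<bar>y\<bar>))"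
proof -
  have "\<bar>x - y\<bar> ^ 3 = \<bar>x - y\<bar> * (x - y)\<^sup>2" by (simp add: power3_eq_cube power2_eq_square abs_mult_self_eq)
  also have "\<dots> \<le> (\<bar>x\<bar> + \<bar>y\<bar>) * (x - y)\<^sup>2" by (intro mult_right_mono) auto
  also have "\<dots> = ((\<bar>x\<bar> * x\<^sup>2 + \<bar>y\<bar> * y\<^sup>2) + (x\<^sup>2 * \<bar>y\<bar> + \<bar>x\<bar> * y\<^sup>2)) - 2 * ((x * \<bar>x\<bar>) * y + x * (y * \<bar>y\<bar>))"
    by (simp add: algebra_simps power2_eq_square)
  also have "\<bar>x\<bar> * x\<^sup>2 = \<bar>x\<bar> ^ 3" by (simp add: power3_eq_cube power2_eq_square abs_mult_self_eq)
  also have "\<bar>y\<bar> * y\<^sup>2 = \<bar>y\<bar> ^ 3" by (simp add: power3_eq_cube power2_eq_square abs_mult_self_eq)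
  finally show ?thesis .
qed

section \<open>Moments and characteristic function of one centered law\<close>

locale centered_third_moment = real_distribution +
  assumes integrable_abs3: "integrable M (\<lambda>x. \<bar>x\<bar> ^ 3)"
    and mean_zero: "(\<integral>x. x \<partial>M) = 0"
begin

definition var :: real where "var = (\<integral>x. x\<^sup>2 \<partial>M)"

definition abs3 :: real where "abs3 = (\<integral>x. \<bar>x\<bar> ^ 3 \<partial>M)"

lemma integrable_dominated:
  fixes h :: "real \<Rightarrow> 'b :: {banach, second_countable_topology}"
  assumes "h \<in> borel_measurable borel" "\<And>x. norm (h x) \<le> 1 + \<bar>x\<bar> ^ 3"
  shows "integrable M h"
proof (rule Bochner_Integration.integrable_bound)
  show "integrable M (\<lambda>x. 1 + \<bar>x\<bar> ^ 3)" using integrable_abs3 by simp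
  show "h \<in> borel_measurable M" using assms(1) by simp
  show "AE x in M. norm (h x) \<le> norm (1 + \<bar>x\<bar> ^ 3)"
    using assms(2) by (auto intro: order_trans)
qed

lemma has_integral_moments:
  shows "has_bochner_integral M (\<lambda>x. x) 0"
    and "has_bochner_integral M (\<lambda>x. x\<^sup>2) var"
    and "has_bochner_integral M (\<lambda>x. \<bar>x\<bar> ^ 3) abs3"
    and "has_bochner_integral M (\<lambda>x. \<bar>x\<bar>) (\<integral>x. \<bar>x\<bar> \<partial>M)"
    and "has_bochner_integral M (\<lambda>x. x * \<bar>x\<bar>) (\<integral>x. x * \<bar>x\<bar> \<partial>M)"
    and "has_bochner_integral M (\<lambda>x. iexp (t * x)) (char M t)"
    and "has_bochner_integral M (\<lambda>x. x * iexp (t * x)) (\<integral>x. x * iexp (t * x) \<partial>M)"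
proof -
  have b: "\<bar>x\<bar> \<le> 1 + \<bar>x\<bar> ^ 3" "x\<^sup>2 \<le> 1 + \<bar>x\<bar> ^ 3" for x :: real
    using power_le_one_plus_cube[of "\<bar>x\<bar>" 1] power_le_one_plus_cube[of "\<bar>x\<bar>" 2] by auto
  have "integrable M (\<lambda>x. x)" "integrable M (\<lambda>x. x\<^sup>2)" "integrable M (\<lambda>x. \<bar>x\<bar>)"
    "integrable M (\<lambda>x. x * \<bar>x\<bar>)" "integrable M (\<lambda>x. iexp (t * x))"
    "integrable M (\<lambda>x. x * iexp (t * x))"
    using b by (intro integrable_dominated; simp add: norm_mult norm_power abs_mult power2_eq_square)+
  then show "has_bochner_integral M (\<lambda>x. x) 0"
    "has_bochner_integral M (\<lambda>x. x\<^sup>2) var"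
    "has_bochner_integral M (\<lambda>x. \<bar>x\<bar> ^ 3) abs3"
    "has_bochner_integral M (\<lambda>x. \<bar>x\<bar>) (\<integral>x. \<bar>x\<bar> \<partial>M)"
    "has_bochner_integral M (\<lambda>x. x * \<bar>x\<bar>) (\<integral>x. x * \<bar>x\<bar> \<partial>M)"
    "has_bochner_integral M (\<lambda>x. iexp (t * x)) (char M t)"
    "has_bochner_integral M (\<lambda>x. x * iexp (t * x)) (\<integral>x. x * iexp (t * x) \<partial>M)"
    using integrable_abs3 mean_zero
    by (simp_all add: has_bochner_integral_iff var_def abs3_def char_def)
qed

lemmas has_integral_complex_moments =
  has_bochner_integral_of_real[OF has_integral_moments(1), where 'a = complex, unfolded of_real_0]
  has_bochner_integral_of_real[OF has_integral_moments(2), where 'a = complex]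

text \<open>With these rules \<open>intro\<close> reads an integral off the shape of the integrand.
  The values below therefore mirror their integrands term by term and keep factors \<open>0\<close>
  for the mean.\<close>

lemmas has_integral_combine =
  has_bochner_integral_add has_bochner_integral_diff has_bochner_integral_mult_right
  has_bochner_integral_const_prob has_integral_moments has_integral_complex_moments

lemma var_nonneg: "0 \<le> var"
  unfolding var_def by simp

lemma abs3_nonneg: "0 \<le> abs3"
  unfolding abs3_def by simp

text \<open>Lyapunov's inequality, from integrating
  \<open>(\<bar>x\<bar> - s)^2 * (2 * \<bar>x\<bar> + s) \<ge> 0\<close> with \<open>s\<close> the
  standard deviation: the cubic and quadratic terms leave
  \<open>2 * abs3 - 2 * s ^ 3\<close>.\<close>

lemma sqrt_var_cube_le_abs3: "sqrt var ^ 3 \<le> abs3"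
proof -
  define s where "s = sqrt var"
  have s: "0 \<le> s" "var = s\<^sup>2" using var_nonneg by (auto simp: s_def)
  have "has_bochner_integral M (\<lambda>x. 2 * \<bar>x\<bar> ^ 3 + (s ^ 3 - 3 * s * x\<^sup>2)) (2 * abs3 + (s ^ 3 - 3 * s * var))"
    by (intro has_integral_combine)
  moreover have "0 \<le> 2 * \<bar>x\<bar> ^ 3 + (s ^ 3 - 3 * s * x\<^sup>2)" for x
  proof -
    have "0 \<le> (\<bar>x\<bar> - s)\<^sup>2 * (2 * \<bar>x\<bar> + s)" using s by simp
    also have "\<dots> = 2 * \<bar>x\<bar> ^ 3 + (s ^ 3 - 3 * s * \<bar>x\<bar>\<^sup>2)"
      by (simp add: algebra_simps power2_eq_square power3_eq_cube del: abs_mult_self_eq)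
    finally show ?thesis by simp
  qed
  ultimately have "0 \<le> 2 * abs3 + (s ^ 3 - 3 * s * var)"
    by (metis (no_types, lifting) has_bochner_integral_integral_eq Bochner_Integration.integral_nonneg)
  then show ?thesis
    using s(1) by (simp add: s(2) power2_eq_square power3_eq_cube flip: s_def)
qed

text \<open>Integrate \<open>(\<bar>x\<bar> - \<bar>y\<bar>)^2 * (\<bar>x\<bar> + \<bar>y\<bar>)
  \<ge> 0\<close> over two copies. It absorbs the mixed moments left by
  \<open>abs_diff_cube_le\<close>.\<close>

lemma var_mult_abs1_le_abs3: "var * (\<integral>x. \<bar>x\<bar> \<partial>M) \<le> abs3"
proof -
  define e where "e = (\<integral>x. \<bar>x\<bar> \<partial>M)"
  note [simp] = e_def[symmetric]
  have "0 \<le> (abs3 + abs3) - (var * e + e * var)"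
  proof (rule iterated_integral_mono)
    show "has_bochner_integral M (\<lambda>y. 0) (0::real)" for x :: real by (rule has_bochner_integral_zero)
    show "has_bochner_integral M (\<lambda>x. 0) (0::real)" by (rule has_bochner_integral_zero)
    show "has_bochner_integral M (\<lambda>y. (\<bar>x\<bar> ^ 3 + \<bar>y\<bar> ^ 3) - (x\<^sup>2 * \<bar>y\<bar> + \<bar>x\<bar> * y\<^sup>2))
      ((\<bar>x\<bar> ^ 3 + abs3) - (x\<^sup>2 * e + \<bar>x\<bar> * var))" for x
      unfolding e_def by (intro has_integral_combine)
    have "has_bochner_integral M (\<lambda>x. (\<bar>x\<bar> ^ 3 + abs3) - (e * x\<^sup>2 + var * \<bar>x\<bar>))
      ((abs3 + abs3) - (e * var + var * e))"
      unfolding e_def by (intro has_integral_combine)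
    then show "has_bochner_integral M (\<lambda>x. (\<bar>x\<bar> ^ 3 + abs3) - (x\<^sup>2 * e + \<bar>x\<bar> * var))
      ((abs3 + abs3) - (var * e + e * var))"
      by (simp add: mult.commute)
    fix x y :: real
    have "0 \<le> (\<bar>x\<bar> - \<bar>y\<bar>)\<^sup>2 * (\<bar>x\<bar> + \<bar>y\<bar>)" by simp
    also have "\<dots> = (\<bar>x\<bar> ^ 3 + \<bar>y\<bar> ^ 3) - (\<bar>x\<bar>\<^sup>2 * \<bar>y\<bar> + \<bar>x\<bar> * \<bar>y\<bar>\<^sup>2)"
      by (simp add: algebra_simps power2_eq_square power3_eq_cube del: abs_mult_self_eq)
    finally show "0 \<le> (\<bar>x\<bar> ^ 3 + \<bar>y\<bar> ^ 3) - (x\<^sup>2 * \<bar>y\<bar> + \<bar>x\<bar> * y\<^sup>2)" by simp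
  qed
  then show ?thesis by (simp add: mult.commute)
qed

text \<open>For a random variable \<open>X\<close> with distribution \<open>M\<close>, an independent copy \<open>Y\<close> and
  \<open>g x = iexp (t * x)\<close>, centering gives
  \<open>2 * (E X g(X) - Var X * E g'(X)) = E (X - Y) * (g X - g Y - X * g' Y + Y * g' X)\<close>,
  and \<open>E \<bar>X - Y\<bar> * \<bar>X * \<bar>X\<bar> - Y * \<bar>Y\<bar>\<bar> = 2 * E \<bar>X\<bar> ^ 3\<close>.\<close>

lemma stein_char_bound:
  "cmod ((\<integral>x. x * iexp (t * x) \<partial>M) - \<i> * t * var * char M t) \<le> abs3 * t\<^sup>2 / 2"
proof -
  define p where "p = (\<integral>x. complex_of_real x * iexp (t * x) \<partial>M)"
  define m where "m = (\<integral>x. x * \<bar>x\<bar> \<partial>M)"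
  define \<kappa> where "\<kappa> = \<i> * complex_of_real t"
  define f where "f = char M t"
  define g where "g x = iexp (t * x)" for x
  define u where "u x = complex_of_real x * g x" for x
  \<comment> \<open>The product from the symmetrized identity, expanded so that every summand is a
    factor independent of \<open>y\<close> times a function of \<open>y\<close> with known
    integral.\<close>
  define L where "L x y = u x - complex_of_real x * g y + u y
      - \<kappa> * complex_of_real (x\<^sup>2) * g y - (\<kappa> * g x) * complex_of_real (y\<^sup>2)
      + \<kappa> * complex_of_real x * u y + (\<kappa> * u x - g x) * complex_of_real y" for x y
  define L1 where "L1 x = u x - complex_of_real x * f + p
      - \<kappa> * complex_of_real (x\<^sup>2) * f - (\<kappa> * g x) * var
      + \<kappa> * complex_of_real x * p + (\<kappa> * u x - g x) * 0" for x
  note moments = has_integral_combine has_integral_moments(6)[of t, folded f_def g_def]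
    has_integral_moments(7)[of t, folded p_def g_def, folded u_def]
    has_integral_moments(5)[folded m_def]
  have "cmod (p - f * 0 + p - (\<kappa> * f) * var - (\<kappa> * var) * f + \<kappa> * p * 0)
    \<le> t\<^sup>2 / 2 * (((abs3 + abs3) - m * 0) - 0 * m)"
  proof (rule iterated_integral_norm_bound)
    fix x :: real
    show "has_bochner_integral M (L x) (L1 x)"
      unfolding L_def L1_def by (intro moments)
    show "has_bochner_integral M (\<lambda>y. t\<^sup>2 / 2 * (((\<bar>x\<bar> ^ 3 + \<bar>y\<bar> ^ 3) - x * (y * \<bar>y\<bar>)) - (x * \<bar>x\<bar>) * y))
      (t\<^sup>2 / 2 * (((\<bar>x\<bar> ^ 3 + abs3) - x * m) - (x * \<bar>x\<bar>) * 0))"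
      by (intro moments)
  next
    have "has_bochner_integral M (\<lambda>x. u x - f * complex_of_real x + p
        - (\<kappa> * f) * complex_of_real (x\<^sup>2) - (\<kappa> * var) * g x + \<kappa> * p * complex_of_real x)
      (p - f * 0 + p - (\<kappa> * f) * var - (\<kappa> * var) * f + \<kappa> * p * 0)"
      by (intro moments)
    then show "has_bochner_integral M L1
        (p - f * 0 + p - (\<kappa> * f) * var - (\<kappa> * var) * f + \<kappa> * p * 0)"
      by (simp add: L1_def[abs_def] ac_simps)
    have "has_bochner_integral M (\<lambda>x. t\<^sup>2 / 2 * ((\<bar>x\<bar> ^ 3 + abs3) - m * x))
      (t\<^sup>2 / 2 * ((abs3 + abs3) - m * 0))"
      by (intro moments)
    then show "has_bochner_integral M (\<lambda>x. t\<^sup>2 / 2 * (((\<bar>x\<bar> ^ 3 + abs3) - x * m) - (x * \<bar>x\<bar>) * 0))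
      (t\<^sup>2 / 2 * (((abs3 + abs3) - m * 0) - 0 * m))"
      by (simp add: mult.commute)
  next
    fix x y :: real
    have "L x y = of_real (x - y) * ((g x - g y) - \<kappa> * (complex_of_real x * g y - complex_of_real y * g x))"
      by (simp add: L_def u_def algebra_simps power2_eq_square)
    then have "cmod (L x y) = \<bar>x - y\<bar> * cmod ((g x - g y) - \<kappa> * (complex_of_real x * g y - complex_of_real y * g x))"
      by (simp only: norm_mult norm_of_real)
    also have "\<dots> \<le> \<bar>x - y\<bar> * (t\<^sup>2 * \<bar>x * \<bar>x\<bar> - y * \<bar>y\<bar>\<bar> / 2)"
      using iexp_trapezoid_bound unfolding \<kappa>_def g_def by (intro mult_left_mono) auto
    also have "\<dots> = t\<^sup>2 / 2 * (\<bar>x - y\<bar> * \<bar>x * \<bar>x\<bar> - y * \<bar>y\<bar>\<bar>)" by simp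
    also have "\<dots> = t\<^sup>2 / 2 * (((\<bar>x\<bar> ^ 3 + \<bar>y\<bar> ^ 3) - x * (y * \<bar>y\<bar>)) - (x * \<bar>x\<bar>) * y)"
      unfolding abs_diff_mult_abs_diff by (simp add: mult.commute)
    finally show "cmod (L x y) \<le> \<dots>" .
  qed
  then have "cmod (2 * (p - \<kappa> * var * f)) \<le> 2 * (abs3 * t\<^sup>2 / 2)"
    by (simp add: algebra_simps)
  then have "cmod (p - \<kappa> * var * f) \<le> abs3 * t\<^sup>2 / 2"
    unfolding norm_mult by simp
  then show ?thesis by (simp add: p_def f_def \<kappa>_def)
qed

text \<open>The first-order Taylor remainder of \<open>iexp\<close> is quadratic and integrates to
  at most \<open>(s - t)^2 * var / 2\<close>, which is of smaller order than
  \<open>s - t\<close>.\<close>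

lemma has_vector_derivative_char:
  "(char M has_vector_derivative \<i> * (\<integral>x. x * iexp (t * x) \<partial>M)) (at t)"
proof -
  define p where "p = (\<integral>x. x * iexp (t * x) \<partial>M)"
  have bound: "cmod (char M s - char M t - of_real (s - t) * (\<i> * p)) \<le> (s - t)\<^sup>2 * (var / 2)" for s
  proof -
    have 1: "has_bochner_integral M (\<lambda>x. iexp (s * x) - iexp (t * x) - (of_real (s - t) * \<i>) * (x * iexp (t * x)))
      (char M s - char M t - (of_real (s - t) * \<i>) * p)"
      unfolding p_def by (intro has_integral_combine)
    have 2: "has_bochner_integral M (\<lambda>x. ((s - t)\<^sup>2 / 2) * x\<^sup>2) (((s - t)\<^sup>2 / 2) * var)"
      by (intro has_integral_combine)
    have "cmod (iexp (s * x) - iexp (t * x) - (of_real (s - t) * \<i>) * (x * iexp (t * x)))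
        \<le> ((s - t)\<^sup>2 / 2) * x\<^sup>2" for x
    proof -
      \<comment> \<open>Splitting off the unimodular factor \<open>iexp (t * x)\<close> reduces the
        expansion at \<open>t\<close> to the one at 0.\<close>
      have "iexp (s * x) = iexp (t * x) * iexp ((s - t) * x)"
        by (simp add: algebra_simps flip: exp_add)
      then have "iexp (s * x) - iexp (t * x) - (of_real (s - t) * \<i>) * (x * iexp (t * x))
          = iexp (t * x) * (iexp ((s - t) * x) - (\<Sum>k\<le>1. (\<i> * ((s - t) * x)) ^ k / fact k))"
        by (simp add: algebra_simps)
      then have "cmod (iexp (s * x) - iexp (t * x) - (of_real (s - t) * \<i>) * (x * iexp (t * x)))
          = cmod (iexp ((s - t) * x) - (\<Sum>k\<le>1. (\<i> * ((s - t) * x)) ^ k / fact k))"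
        by (simp only: norm_mult norm_exp_i_times)
      also have "\<dots> \<le> \<bar>(s - t) * x\<bar> ^ Suc 1 / fact (Suc 1)" by (rule iexp_approx1)
      also have "\<dots> = ((s - t)\<^sup>2 / 2) * x\<^sup>2" by (simp add: power_mult_distrib flip: power2_eq_square)
      finally show ?thesis .
    qed
    with 1 2 show ?thesis
      using Bochner_Integration.integral_norm_bound_integral[of M _ "\<lambda>x. ((s - t)\<^sup>2 / 2) * x\<^sup>2"]
      by (fastforce simp: has_bochner_integral_iff mult.assoc)
  qed
  have "((\<lambda>s. (char M s - char M t - of_real (s - t) * (\<i> * p)) /\<^sub>R \<bar>s - t\<bar>) \<longlongrightarrow> 0) (at t)"
  proof (rule Lim_null_comparison)
    show "((\<lambda>s. \<bar>s - t\<bar> * (var / 2)) \<longlongrightarrow> 0) (at t)"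
      by (auto intro!: tendsto_eq_intros)
    show "\<forall>\<^sub>F s in at t. norm ((char M s - char M t - of_real (s - t) * (\<i> * p)) /\<^sub>R \<bar>s - t\<bar>) \<le> \<bar>s - t\<bar> * (var / 2)"
    proof (intro always_eventually allI)
      fix s
      show "norm ((char M s - char M t - of_real (s - t) * (\<i> * p)) /\<^sub>R \<bar>s - t\<bar>) \<le> \<bar>s - t\<bar> * (var / 2)"
      proof (cases "s = t")
        case False
        then show ?thesis using bound[of s]
          by (simp add: divide_simps power2_eq_square ac_simps abs_mult_self_eq flip: abs_mult)
      qed simp
    qed
  qed
  then show ?thesis
    unfolding has_vector_derivative_def has_derivative_at_within p_def[symmetric]
    by (intro conjI bounded_linear_scaleR_left) (simp add: scaleR_conv_of_real algebra_simps)
qed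

text \<open>The combination \<open>f' + t * var * f\<close> vanishes for the centered normal law of
  variance \<open>var\<close>; it is the quantity of \<open>stein_char_bound\<close> multiplied by
  the imaginary unit.\<close>

lemma char_deriv_bound:
  obtains f' where "(char M has_vector_derivative f') (at t)"
    "cmod (f' + of_real (t * var) * char M t) \<le> abs3 * t\<^sup>2 / 2"
proof (rule that)
  have "\<i> * (\<integral>x. x * iexp (t * x) \<partial>M) + of_real (t * var) * char M t
      = \<i> * ((\<integral>x. x * iexp (t * x) \<partial>M) - \<i> * t * var * char M t)"
    by (simp add: algebra_simps)
  then show "cmod (\<i> * (\<integral>x. x * iexp (t * x) \<partial>M) + of_real (t * var) * char M t) \<le> abs3 * t\<^sup>2 / 2"
    using stein_char_bound by (simp only: norm_mult norm_ii mult_1)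
qed (rule has_vector_derivative_char)

lemma norm_char_le:
  assumes "0 \<le> d" "\<And>u. cos u \<le> 1 - c * u\<^sup>2 + d * \<bar>u\<bar> ^ 3"
  shows "cmod (char M t) \<le> exp (- c * t\<^sup>2 * var + 2 * d * \<bar>t\<bar> ^ 3 * abs3)"
proof -
  define C where "C = Re (char M t)"
  define D where "D = Im (char M t)"
  define e where "e = (\<integral>x. \<bar>x\<bar> \<partial>M)"
  define m where "m = (\<integral>x. x * \<bar>x\<bar> \<partial>M)"
  have "has_bochner_integral M (\<lambda>x. Re (iexp (t * x))) C" "has_bochner_integral M (\<lambda>x. Im (iexp (t * x))) D"
    unfolding C_def D_def
    by (rule has_bochner_integral_bounded_linear[OF bounded_linear_Re has_integral_moments(6)]
        has_bochner_integral_bounded_linear[OF bounded_linear_Im has_integral_moments(6)])+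
  then have trig: "has_bochner_integral M (\<lambda>x. cos (t * x)) C" "has_bochner_integral M (\<lambda>x. sin (t * x)) D"
    by (simp_all add: Re_exp Im_exp)
  note moments = has_integral_combine trig has_integral_moments(4)[folded e_def] has_integral_moments(5)[folded m_def]
  \<comment> \<open>The left side is the squared modulus of \<open>char M t\<close>, namely the
    double integral of \<open>cos (t * (x - y))\<close>.\<close>
  have "C * C + D * D \<le> 1 - c * t\<^sup>2 * ((var + var) - 2 * (0 * 0)) + d * \<bar>t\<bar> ^ 3 *
      (((abs3 + abs3) + (e * var + var * e)) - 2 * (0 * m + m * 0))"
  proof (rule iterated_integral_mono)
    fix x :: real
    show "has_bochner_integral M (\<lambda>y. cos (t * x) * cos (t * y) + sin (t * x) * sin (t * y))
      (cos (t * x) * C + sin (t * x) * D)"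
      by (intro moments)
    show "has_bochner_integral M (\<lambda>y. 1 - c * t\<^sup>2 * ((x\<^sup>2 + y\<^sup>2) - 2 * (x * y)) + d * \<bar>t\<bar> ^ 3 *
        (((\<bar>x\<bar> ^ 3 + \<bar>y\<bar> ^ 3) + (x\<^sup>2 * \<bar>y\<bar> + \<bar>x\<bar> * y\<^sup>2)) - 2 * ((x * \<bar>x\<bar>) * y + x * (y * \<bar>y\<bar>))))
      (1 - c * t\<^sup>2 * ((x\<^sup>2 + var) - 2 * (x * 0)) + d * \<bar>t\<bar> ^ 3 *
        (((\<bar>x\<bar> ^ 3 + abs3) + (x\<^sup>2 * e + \<bar>x\<bar> * var)) - 2 * ((x * \<bar>x\<bar>) * 0 + x * m)))"
      by (intro moments)
  next
    have "has_bochner_integral M (\<lambda>x. C * cos (t * x) + D * sin (t * x)) (C * C + D * D)"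
      by (intro moments)
    then show "has_bochner_integral M (\<lambda>x. cos (t * x) * C + sin (t * x) * D) (C * C + D * D)"
      by (simp add: mult.commute)
    have "has_bochner_integral M (\<lambda>x. 1 - c * t\<^sup>2 * (x\<^sup>2 + var) + d * \<bar>t\<bar> ^ 3 *
        (((\<bar>x\<bar> ^ 3 + abs3) + (e * x\<^sup>2 + var * \<bar>x\<bar>)) - 2 * (m * x)))
      (1 - c * t\<^sup>2 * (var + var) + d * \<bar>t\<bar> ^ 3 * (((abs3 + abs3) + (e * var + var * e)) - 2 * (m * 0)))"
      by (intro moments)
    then show "has_bochner_integral M (\<lambda>x. 1 - c * t\<^sup>2 * ((x\<^sup>2 + var) - 2 * (x * 0)) + d * \<bar>t\<bar> ^ 3 *
        (((\<bar>x\<bar> ^ 3 + abs3) + (x\<^sup>2 * e + \<bar>x\<bar> * var)) - 2 * ((x * \<bar>x\<bar>) * 0 + x * m)))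
      (1 - c * t\<^sup>2 * ((var + var) - 2 * (0 * 0)) + d * \<bar>t\<bar> ^ 3 *
      (((abs3 + abs3) + (e * var + var * e)) - 2 * (0 * m + m * 0)))"
      by (simp add: mult.commute)
  next
    fix x y :: real
    have "cos (t * x) * cos (t * y) + sin (t * x) * sin (t * y) = cos (t * (x - y))"
      by (simp add: cos_diff algebra_simps)
    also have "\<dots> \<le> 1 - c * (t * (x - y))\<^sup>2 + d * \<bar>t * (x - y)\<bar> ^ 3" by (rule assms)
    also have "\<dots> = 1 - c * t\<^sup>2 * ((x\<^sup>2 + y\<^sup>2) - 2 * (x * y)) + d * \<bar>t\<bar> ^ 3 * \<bar>x - y\<bar> ^ 3"
      by (simp add: abs_mult power_mult_distrib power2_diff)
    also have "\<dots> \<le> 1 - c * t\<^sup>2 * ((x\<^sup>2 + y\<^sup>2) - 2 * (x * y)) + d * \<bar>t\<bar> ^ 3 *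
        (((\<bar>x\<bar> ^ 3 + \<bar>y\<bar> ^ 3) + (x\<^sup>2 * \<bar>y\<bar> + \<bar>x\<bar> * y\<^sup>2)) - 2 * ((x * \<bar>x\<bar>) * y + x * (y * \<bar>y\<bar>)))"
      using assms(1) abs_diff_cube_le by (intro add_left_mono mult_left_mono) auto
    finally show "cos (t * x) * cos (t * y) + sin (t * x) * sin (t * y) \<le> \<dots>" .
  qed
  also have "\<dots> = 1 - 2 * (c * t\<^sup>2 * var) + d * \<bar>t\<bar> ^ 3 * (2 * abs3 + 2 * (var * e))"
    by (simp add: algebra_simps)
  also have "\<dots> \<le> 1 - 2 * (c * t\<^sup>2 * var) + d * \<bar>t\<bar> ^ 3 * (2 * abs3 + 2 * abs3)"
    using assms(1) var_mult_abs1_le_abs3 by (intro add_left_mono mult_left_mono) (auto simp: e_def)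
  also have "\<dots> = 1 + 2 * (- c * t\<^sup>2 * var + 2 * d * \<bar>t\<bar> ^ 3 * abs3)"
    by (simp add: algebra_simps)
  \<comment> \<open>The estimate \<open>1 + z \<le> exp z\<close> makes the bound multiplicative;
    the factor 2 in the exponent disappears with the square root.\<close>
  also have "\<dots> \<le> exp (2 * (- c * t\<^sup>2 * var + 2 * d * \<bar>t\<bar> ^ 3 * abs3))"
    by (rule exp_ge_add_one_self)
  also have "\<dots> = (exp (- c * t\<^sup>2 * var + 2 * d * \<bar>t\<bar> ^ 3 * abs3))\<^sup>2"
    by (rule exp_double)
  finally have "(cmod (char M t))\<^sup>2 \<le> (exp (- c * t\<^sup>2 * var + 2 * d * \<bar>t\<bar> ^ 3 * abs3))\<^sup>2"
    unfolding C_def D_def by (simp add: cmod_power2 flip: power2_eq_square)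
  then show ?thesis by (rule power2_le_imp_le) simp
qed

end

subsection \<open>Products of characteristic functions\<close>

lemma const_l_le: "0 \<le> u \<Longrightarrow> const_l \<le> exp (- u\<^sup>2 / 2 + 2 * const_a * u ^ 3)"
  unfolding const_l_def by (rule cINF_lower) (auto intro: bdd_belowI2[of _ 0])

text \<open>The exponent equals \<open>u^2 / 2 * (4 * const_a * u - 1)\<close>. It is nonnegative
  from \<open>1 / (4 * const_a)\<close> on, and before that point it is bounded below by means of
  \<open>u^2\<close>.\<close>

lemma const_l_pos: "0 < const_l"
proof -
  have "exp (- (1 / (4 * const_a))\<^sup>2) \<le> const_l"
    unfolding const_l_def
  proof (rule cINF_greatest)
    fix u :: real assume "u \<in> {0..}"
    then have u: "0 \<le> u" by simp
    have "- (1 / (4 * const_a))\<^sup>2 \<le> - u\<^sup>2 / 2 + 2 * const_a * u ^ 3"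
    proof (cases "u \<le> 1 / (4 * const_a)")
      case True
      then have "u\<^sup>2 \<le> (1 / (4 * const_a))\<^sup>2" using u by (intro power_mono)
      moreover have "0 \<le> 2 * const_a * u ^ 3" using const_a_pos u by simp
      ultimately show ?thesis using zero_le_power2[of u] by linarith
    next
      case False
      then have "1 \<le> 4 * const_a * u" using const_a_pos by (simp add: field_simps)
      then have "1 * (u\<^sup>2 / 2) \<le> 4 * const_a * u * (u\<^sup>2 / 2)" by (intro mult_right_mono) auto
      then have "0 \<le> - u\<^sup>2 / 2 + 2 * const_a * u ^ 3"
        by (simp add: power2_eq_square power3_eq_cube)
      then show ?thesis by (smt (verit) zero_le_power2)
    qed
    then show "exp (- (1 / (4 * const_a))\<^sup>2) \<le> exp (- u\<^sup>2 / 2 + 2 * const_a * u ^ 3)" by simp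
  qed auto
  then show ?thesis by (meson exp_gt_zero less_le_trans)
qed

lemma char_minus: "char M (- t) = cnj (char M t)"
  unfolding char_def by (subst Bochner_Integration.integral_cnj[symmetric]) (simp add: exp_cnj del: Bochner_Integration.integral_cnj)

section \<open>Finite families of centered laws with total variance one\<close>

locale normalized_third_moments =
  fixes I :: "'i set" and \<mu> :: "'i \<Rightarrow> real measure"
  assumes finite_I: "finite I"
    and centered: "j \<in> I \<Longrightarrow> centered_third_moment (\<mu> j)"
    and sum_var: "(\<Sum>j\<in>I. centered_third_moment.var (\<mu> j)) = 1"
begin

definition v :: "'i \<Rightarrow> real" where "v j = centered_third_moment.var (\<mu> j)"

definition \<beta> :: "'i \<Rightarrow> real" where "\<beta> j = centered_third_moment.abs3 (\<mu> j)"

definition lyapunov :: real where "lyapunov = (\<Sum>j\<in>I. \<beta> j)"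

definition F :: "real \<Rightarrow> complex" where "F t = (\<Prod>j\<in>I. char (\<mu> j) t)"

lemma sum_v: "(\<Sum>j\<in>I. v j) = 1"
  using sum_var by (simp add: v_def)

lemma v_nonneg: "j \<in> I \<Longrightarrow> 0 \<le> v j"
  unfolding v_def by (rule centered_third_moment.var_nonneg[OF centered])

lemma \<beta>_nonneg: "j \<in> I \<Longrightarrow> 0 \<le> \<beta> j"
  unfolding \<beta>_def by (rule centered_third_moment.abs3_nonneg[OF centered])

lemma sqrt_v_cube_le: "j \<in> I \<Longrightarrow> sqrt (v j) ^ 3 \<le> \<beta> j"
  unfolding v_def \<beta>_def by (rule centered_third_moment.sqrt_var_cube_le_abs3[OF centered])

lemma \<beta>_le_lyapunov: "j \<in> I \<Longrightarrow> \<beta> j \<le> lyapunov"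
  unfolding lyapunov_def using finite_I \<beta>_nonneg by (intro member_le_sum) auto

lemma lyapunov_pos: "0 < lyapunov"
proof -
  obtain j where j: "j \<in> I" "v j \<noteq> 0" using sum_v by (metis sum.neutral zero_neq_one)
  then have "0 < sqrt (v j) ^ 3" using v_nonneg[of j] by simp
  then show ?thesis using sqrt_v_cube_le[of j] \<beta>_le_lyapunov[of j] j by linarith
qed

lemma norm_char_le_1: "j \<in> I \<Longrightarrow> cmod (char (\<mu> j) t) \<le> 1"
  by (rule real_distribution.cmod_char_le_1[OF centered_third_moment.axioms(1)[OF centered]])

text \<open>The index set is a subset \<open>J\<close> because the bound is applied both to the
  whole product and to products with one factor removed.\<close>

lemma norm_prod_char_le:
  assumes "J \<subseteq> I" "0 \<le> d" "\<And>u. cos u \<le> 1 - c * u\<^sup>2 + d * \<bar>u\<bar> ^ 3"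
  shows "(\<Prod>j\<in>J. cmod (char (\<mu> j) t)) \<le> exp (- c * t\<^sup>2 * (\<Sum>j\<in>J. v j) + 2 * d * \<bar>t\<bar> ^ 3 * (\<Sum>j\<in>J. \<beta> j))"
proof -
  have "(\<Prod>j\<in>J. cmod (char (\<mu> j) t)) \<le> (\<Prod>j\<in>J. exp (- c * t\<^sup>2 * v j + 2 * d * \<bar>t\<bar> ^ 3 * \<beta> j))"
    using assms centered_third_moment.norm_char_le[OF centered]
    by (intro prod_mono) (auto simp: v_def \<beta>_def)
  also have "\<dots> = exp (\<Sum>j\<in>J. - c * t\<^sup>2 * v j + 2 * d * \<bar>t\<bar> ^ 3 * \<beta> j)"
    by (rule exp_sum[symmetric]) (use assms(1) finite_I in \<open>auto intro: finite_subset\<close>)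
  also have "(\<Sum>j\<in>J. - c * t\<^sup>2 * v j + 2 * d * \<bar>t\<bar> ^ 3 * \<beta> j)
      = - c * t\<^sup>2 * (\<Sum>j\<in>J. v j) + 2 * d * \<bar>t\<bar> ^ 3 * (\<Sum>j\<in>J. \<beta> j)"
    unfolding sum.distrib sum_distrib_left ..
  finally show ?thesis .
qed

text \<open>For \<theta> > 0, a majorant with coefficients \<open>c\<close> and \<open>d\<close>
  gives the exponent \<open>- (c - d * \<theta>) * t^2\<close>, and \<open>c - d * \<theta>\<close>
  cannot exceed \<open>cos_ratio \<theta>\<close>. Tangency at \<theta> reaches that value; below
  \<open>argmax_pt\<close> the majorant at \<open>argmax_pt\<close> is used, and beyond
  \<open>2 * pi\<close> the trivial bound 1.\<close>

lemma norm_F_le: "cmod (F t) \<le> exp (b_fun t (2 * lyapunov) / 2)"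
proof -
  define \<theta> where "\<theta> = 2 * lyapunov * \<bar>t\<bar>"
  have bound: "cmod (F t) \<le> exp (- c * t\<^sup>2 + 2 * d * \<bar>t\<bar> ^ 3 * lyapunov)"
    if "0 \<le> d" "\<And>u. cos u \<le> 1 - c * u\<^sup>2 + d * \<bar>u\<bar> ^ 3" for c d
    using norm_prod_char_le[OF subset_refl that] by (simp add: F_def prod_norm sum_v lyapunov_def)
  consider "\<theta> < argmax_pt" | "argmax_pt \<le> \<theta>" "\<theta> \<le> 2 * pi" | "argmax_pt \<le> \<theta>" "2 * pi < \<theta>"
    by linarith
  then show ?thesis
  proof cases
    case 1
    have "cmod (F t) \<le> exp (- (1 / 2) * t\<^sup>2 + 2 * const_a * \<bar>t\<bar> ^ 3 * lyapunov)"
      using const_a_pos cos_le_const_a by (intro bound) auto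
    then show ?thesis using 1 by (simp add: b_fun_def \<theta>_def field_simps)
  next
    case 2
    then have "0 < \<theta>" using argmax_pt_gt_pi pi_gt_zero by linarith
    then have t: "t \<noteq> 0" by (auto simp: \<theta>_def)
    obtain c d where cd: "0 \<le> d" "\<And>u. cos u \<le> 1 - c * u\<^sup>2 + d * \<bar>u\<bar> ^ 3"
        "c - d * \<theta> = (1 - cos \<theta>) / \<theta>\<^sup>2"
      using cos_le_tangent 2 by blast
    have "- c * t\<^sup>2 + 2 * d * \<bar>t\<bar> ^ 3 * lyapunov = - (c - d * \<theta>) * t\<^sup>2"
      by (simp add: \<theta>_def power2_eq_square power3_eq_cube algebra_simps abs_mult_self_eq)
    also have "\<dots> = - ((1 - cos \<theta>) / \<theta>\<^sup>2) * t\<^sup>2" unfolding cd(3) ..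
    also have "cos \<theta> = cos (2 * lyapunov * t)"
      using cos_abs_real[of "2 * lyapunov * t"] lyapunov_pos by (simp add: \<theta>_def abs_mult)
    also have "- ((1 - cos (2 * lyapunov * t)) / \<theta>\<^sup>2) * t\<^sup>2
        = - (1 - cos (2 * lyapunov * t)) / (2 * lyapunov)\<^sup>2"
      using t lyapunov_pos by (simp add: \<theta>_def power_mult_distrib divide_simps)
    also have "\<dots> = b_fun t (2 * lyapunov) / 2"
      using 2 lyapunov_pos by (simp add: b_fun_def \<theta>_def field_simps)
    finally show ?thesis using bound[OF cd(1,2)] by (simp only:)
  next
    case 3
    have "(\<Prod>j\<in>I. cmod (char (\<mu> j) t)) \<le> 1"
      using norm_char_le_1 by (intro prod_le_1) auto
    then show ?thesis using 3 by (simp add: b_fun_def \<theta>_def F_def prod_norm)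
  qed
qed

lemma has_vector_derivative_F:
  "\<exists>F'. (F has_vector_derivative F') (at t) \<and>
    cmod (F' + t * F t) \<le> (\<Sum>j\<in>I. \<beta> j * t\<^sup>2 / 2 * (\<Prod>k\<in>I - {j}. cmod (char (\<mu> k) t)))"
proof -
  have "\<exists>f'. (char (\<mu> j) has_vector_derivative f') (at t) \<and>
      cmod (f' + of_real (t * v j) * char (\<mu> j) t) \<le> \<beta> j * t\<^sup>2 / 2" if "j \<in> I" for j
    using centered_third_moment.char_deriv_bound[OF centered[OF that]]
    unfolding v_def \<beta>_def by metis
  then obtain f' where f': "\<And>j. j \<in> I \<Longrightarrow> (char (\<mu> j) has_vector_derivative f' j) (at t)"
    "\<And>j. j \<in> I \<Longrightarrow> cmod (f' j + of_real (t * v j) * char (\<mu> j) t) \<le> \<beta> j * t\<^sup>2 / 2"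
    by metis
  define P where "P = (\<lambda>j. \<Prod>k\<in>I - {j}. char (\<mu> k) t)"
  define F' where "F' = (\<Sum>j\<in>I. f' j * P j)"
  have "(F has_derivative (\<lambda>y. \<Sum>j\<in>I. (y *\<^sub>R f' j) * P j)) (at t)"
    unfolding F_def P_def using f'(1) by (intro has_derivative_prod) (simp add: has_vector_derivative_def)
  then have "(F has_vector_derivative F') (at t)"
    by (simp add: has_vector_derivative_def F'_def scaleR_sum_right)
  moreover have "cmod (F' + t * F t) \<le> (\<Sum>j\<in>I. \<beta> j * t\<^sup>2 / 2 * (\<Prod>k\<in>I - {j}. cmod (char (\<mu> k) t)))"
  proof -
    have split: "F t = char (\<mu> j) t * P j" if "j \<in> I" for j
      unfolding F_def P_def using finite_I that by (rule prod.remove)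
    \<comment> \<open>Total variance one distributes \<open>t * F t\<close> over the indices, so
      that each share joins the corresponding term of the product rule.\<close>
    have "t * F t = of_real (\<Sum>j\<in>I. v j) * (t * F t)" by (simp add: sum_v)
    also have "\<dots> = (\<Sum>j\<in>I. of_real (t * v j) * F t)"
      by (simp add: sum_distrib_left mult_ac)
    also have "\<dots> = (\<Sum>j\<in>I. of_real (t * v j) * (char (\<mu> j) t * P j))"
      using split by (intro sum.cong refl) metis
    finally have "F' + t * F t = (\<Sum>j\<in>I. (f' j + of_real (t * v j) * char (\<mu> j) t) * P j)"
      by (simp add: F'_def sum.distrib algebra_simps)
    also have "cmod \<dots> \<le> (\<Sum>j\<in>I. \<beta> j * t\<^sup>2 / 2 * cmod (P j))"
      using f'(2) by (intro sum_norm_le) (auto simp only: norm_mult intro!: mult_right_mono norm_ge_zero)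
    finally show ?thesis by (simp add: P_def prod_norm)
  qed
  ultimately show ?thesis by blast
qed

section \<open>Distance to the normal characteristic function\<close>

definition G :: "real \<Rightarrow> complex" where "G s = complex_of_real (exp (s\<^sup>2 / 2)) * F s"

text \<open>\<open>G\<close> is the quotient of \<open>F\<close> by the normal characteristic
  function, with derivative \<open>exp (s^2 / 2) * (F' + s * F)\<close>. The bound \<open>K\<close>
  is uniform in \<open>j\<close>, so the weights \<open>\<beta> j\<close> add up to
  \<open>lyapunov\<close>; the interval is arbitrary so that different \<open>K\<close> can be used
  on adjacent intervals.\<close>

lemma norm_G_diff_le:
  assumes "u \<le> w" "continuous_on {u..w} K"
    and K: "\<And>s j. s \<in> {u..w} \<Longrightarrow> j \<in> I \<Longrightarrow> exp (s\<^sup>2 / 2) * (\<Prod>k\<in>I - {j}. cmod (char (\<mu> k) s)) \<le> K s"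
  shows "cmod (G w - G u) \<le> lyapunov * integral {u..w} (\<lambda>s. s\<^sup>2 / 2 * K s)"
proof -
  have "\<forall>s. \<exists>F'. (F has_vector_derivative F') (at s) \<and>
    cmod (F' + s * F s) \<le> (\<Sum>j\<in>I. \<beta> j * s\<^sup>2 / 2 * (\<Prod>k\<in>I - {j}. cmod (char (\<mu> k) s)))"
    using has_vector_derivative_F by blast
  from choice[OF this] obtain F' where F': "\<And>s. (F has_vector_derivative F' s) (at s)"
    "\<And>s. cmod (F' s + s * F s) \<le> (\<Sum>j\<in>I. \<beta> j * s\<^sup>2 / 2 * (\<Prod>k\<in>I - {j}. cmod (char (\<mu> k) s)))"
    by blast
  have "((\<lambda>s. exp (s\<^sup>2 / 2)) has_real_derivative s * exp (s\<^sup>2 / 2)) (at s)" for s :: real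
    by (auto intro!: derivative_eq_intros)
  then have "(G has_vector_derivative of_real (exp (s\<^sup>2 / 2)) * F' s + of_real (s * exp (s\<^sup>2 / 2)) * F s) (at s)" for s
    unfolding G_def
    by (intro has_vector_derivative_mult has_vector_derivative_of_real F')
      (simp add: has_real_derivative_iff_has_vector_derivative)
  then have int: "((\<lambda>s. complex_of_real (exp (s\<^sup>2 / 2)) * (F' s + s * F s)) has_integral G w - G u) {u..w}"
    using assms(1) by (intro fundamental_theorem_of_calculus)
      (auto simp: algebra_simps intro: has_vector_derivative_at_within)
  have int_K: "(\<lambda>s. lyapunov * (s\<^sup>2 / 2 * K s)) integrable_on {u..w}"
    using assms(2) by (intro integrable_continuous_real continuous_intros) auto
  have "cmod (of_real (exp (s\<^sup>2 / 2)) * (F' s + s * F s)) \<le> lyapunov * (s\<^sup>2 / 2 * K s)" if s: "s \<in> {u..w}" for s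
  proof -
    have "cmod (of_real (exp (s\<^sup>2 / 2)) * (F' s + s * F s))
        \<le> exp (s\<^sup>2 / 2) * (\<Sum>j\<in>I. \<beta> j * s\<^sup>2 / 2 * (\<Prod>k\<in>I - {j}. cmod (char (\<mu> k) s)))"
      using F'(2) by (simp only: norm_mult norm_of_real abs_exp_cancel mult_le_cancel_left_pos exp_gt_zero)
    also have "\<dots> = (\<Sum>j\<in>I. \<beta> j * s\<^sup>2 / 2 * (exp (s\<^sup>2 / 2) * (\<Prod>k\<in>I - {j}. cmod (char (\<mu> k) s))))"
      by (simp add: sum_distrib_left mult_ac)
    also have "\<dots> \<le> (\<Sum>j\<in>I. \<beta> j * s\<^sup>2 / 2 * K s)"
      using K[OF s] \<beta>_nonneg by (intro sum_mono mult_left_mono) auto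
    also have "\<dots> = lyapunov * (s\<^sup>2 / 2 * K s)"
      unfolding lyapunov_def sum_distrib_right by (intro sum.cong) simp_all
    finally show ?thesis .
  qed
  from Henstock_Kurzweil_Integration.integral_norm_bound_integral[OF has_integral_integrable[OF int] int_K this]
  have "cmod (G w - G u) \<le> integral {u..w} (\<lambda>s. lyapunov * (s\<^sup>2 / 2 * K s))"
    by (simp only: integral_unique[OF int])
  then show ?thesis by simp
qed

text \<open>Multiplication by the normal characteristic function undoes the quotient, with
  \<open>G 0 = 1\<close>. Negative \<open>t\<close> reduces to \<open>\<bar>t\<bar>\<close> since
  \<open>F (- t)\<close> is the conjugate of \<open>F t\<close>.\<close>

lemma norm_F_diff_normal_le:
  assumes "cmod (G \<bar>t\<bar> - G 0) \<le> lyapunov * B"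
  shows "cmod (F t - of_real (exp (- t\<^sup>2 / 2))) \<le> lyapunov * exp (- t\<^sup>2 / 2) * B"
proof -
  have G0: "G 0 = 1"
    using real_distribution.char_zero[OF centered_third_moment.axioms(1)[OF centered]]
    by (simp add: G_def F_def)
  have "F (- t) = cnj (F t)"
    by (simp add: F_def char_minus)
  then have "cmod (F t - of_real (exp (- t\<^sup>2 / 2))) = cmod (F \<bar>t\<bar> - of_real (exp (- t\<^sup>2 / 2)))"
    by (metis abs_if complex_cnj_complex_of_real complex_cnj_diff complex_mod_cnj)
  moreover have "exp (- t\<^sup>2 / 2) * exp (t\<^sup>2 / 2) = 1" by (simp flip: exp_add)
  then have "complex_of_real (exp (- t\<^sup>2 / 2)) * G \<bar>t\<bar> = F \<bar>t\<bar>"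
    by (simp add: G_def flip: mult.assoc of_real_mult del: of_real_exp)
  then have "F \<bar>t\<bar> - of_real (exp (- t\<^sup>2 / 2)) = of_real (exp (- t\<^sup>2 / 2)) * (G \<bar>t\<bar> - G 0)"
    by (simp add: G0 right_diff_distrib)
  ultimately have "cmod (F t - of_real (exp (- t\<^sup>2 / 2))) = exp (- t\<^sup>2 / 2) * cmod (G \<bar>t\<bar> - G 0)"
    by (simp only: norm_mult norm_of_real abs_exp_cancel)
  also have "\<dots> \<le> exp (- t\<^sup>2 / 2) * (lyapunov * B)"
    using assms by (rule mult_left_mono) simp
  finally show ?thesis by (simp add: mult_ac)
qed

text \<open>Without the factor \<open>j\<close> the remaining variance is \<open>1 - v j\<close>, so
  the Gaussian weight leaves only \<open>v j * s^2 / 2\<close>.\<close>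

lemma norm_prod_char_remove_le:
  assumes "j \<in> I" "0 \<le> s"
  shows "exp (s\<^sup>2 / 2) * (\<Prod>k\<in>I - {j}. cmod (char (\<mu> k) s))
    \<le> exp (v j * s\<^sup>2 / 2 + 2 * const_a * s ^ 3 * (lyapunov - \<beta> j))"
proof -
  have "(\<Prod>k\<in>I - {j}. cmod (char (\<mu> k) s))
      \<le> exp (- (1 / 2) * s\<^sup>2 * (\<Sum>k\<in>I - {j}. v k) + 2 * const_a * \<bar>s\<bar> ^ 3 * (\<Sum>k\<in>I - {j}. \<beta> k))"
    using const_a_pos cos_le_const_a by (intro norm_prod_char_le) auto
  also have "(\<Sum>k\<in>I - {j}. v k) = 1 - v j"
    using finite_I assms(1) sum_v by (simp add: sum_diff1)
  also have "(\<Sum>k\<in>I - {j}. \<beta> k) = lyapunov - \<beta> j"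
    using finite_I assms(1) by (simp add: sum_diff1 lyapunov_def)
  finally have "exp (s\<^sup>2 / 2) * (\<Prod>k\<in>I - {j}. cmod (char (\<mu> k) s))
      \<le> exp (s\<^sup>2 / 2) * exp (- (1 / 2) * s\<^sup>2 * (1 - v j) + 2 * const_a * \<bar>s\<bar> ^ 3 * (lyapunov - \<beta> j))"
    by (rule mult_left_mono) simp
  also have "\<dots> = exp (v j * s\<^sup>2 / 2 + 2 * const_a * s ^ 3 * (lyapunov - \<beta> j))"
    using assms(2) by (simp add: field_simps flip: exp_add)
  finally show ?thesis .
qed

text \<open>With \<open>w = sqrt (v j)\<close>, so that \<open>w ^ 3 \<le> \<beta> j\<close> and
  \<open>w \<le> e\<close>, the exponent is at most
  \<open>w^2 * s^2 / 2 + 2 * const_a * s ^ 3 * (e ^ 3 - w ^ 3)\<close>. In the given range of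
  \<open>s\<close> this is largest at \<open>w = e\<close>.\<close>

lemma norm_prod_char_remove_le_near:
  assumes "j \<in> I" "0 \<le> s" "0 < e" "lyapunov = e ^ 3" "s \<le> 1 / (6 * const_a * e)"
  shows "exp (s\<^sup>2 / 2) * (\<Prod>k\<in>I - {j}. cmod (char (\<mu> k) s)) \<le> exp (s\<^sup>2 * e\<^sup>2 / 2)"
proof -
  define w where "w = sqrt (v j)"
  have w: "0 \<le> w" "v j = w\<^sup>2" "w ^ 3 \<le> \<beta> j"
    using v_nonneg[OF assms(1)] sqrt_v_cube_le[OF assms(1)] by (auto simp: w_def)
  have "w ^ 3 \<le> e ^ 3" using w(3) \<beta>_le_lyapunov[OF assms(1)] assms(4) by simp
  have "const_a * s * e \<le> 1 / 6"
    using assms const_a_pos by (simp add: field_simps)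
  \<comment> \<open>After multiplication by \<open>6 * e\<close> and use of
    \<open>const_a * s * e \<le> 1 / 6\<close>, the gap that remains is
    \<open>s^2 * (e ^ 3 - 3 * e * w^2 + 2 * w ^ 3)\<close>, which factors as
    \<open>s^2 * (e - w)^2 * (e + 2 * w)\<close>.\<close>
  then have "12 * s\<^sup>2 * (e ^ 3 - w ^ 3) * (const_a * s * e) \<le> 12 * s\<^sup>2 * (e ^ 3 - w ^ 3) * (1 / 6)"
    using \<open>w ^ 3 \<le> e ^ 3\<close> by (intro mult_left_mono) auto
  moreover have "0 \<le> s\<^sup>2 * ((e - w)\<^sup>2 * (e + 2 * w))"
    using w assms by simp
  ultimately have "6 * e * (w\<^sup>2 * s\<^sup>2 / 2 + 2 * const_a * s ^ 3 * (e ^ 3 - w ^ 3)) \<le> 6 * e * (s\<^sup>2 * e\<^sup>2 / 2)"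
    by (simp add: algebra_simps power2_eq_square power3_eq_cube)
  then have "w\<^sup>2 * s\<^sup>2 / 2 + 2 * const_a * s ^ 3 * (e ^ 3 - w ^ 3) \<le> s\<^sup>2 * e\<^sup>2 / 2"
    using assms(3) by (subst (asm) mult_le_cancel_left_pos) auto
  moreover have "2 * const_a * s ^ 3 * (lyapunov - \<beta> j) \<le> 2 * const_a * s ^ 3 * (e ^ 3 - w ^ 3)"
    using assms w const_a_pos by (intro mult_left_mono) auto
  ultimately have "exp (v j * s\<^sup>2 / 2 + 2 * const_a * s ^ 3 * (lyapunov - \<beta> j)) \<le> exp (s\<^sup>2 * e\<^sup>2 / 2)"
    by (simp add: w(2))
  then show ?thesis using norm_prod_char_remove_le[OF assms(1,2)] by linarith
qed

text \<open>The part of the exponent depending on \<open>j\<close> is at most \<open>- z\<close>,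
  where \<open>z\<close> is the exponent in the definition of \<open>const_l\<close> taken at
  \<open>w * s\<close>; hence \<open>exp (- z) \<le> 1 / const_l\<close>.\<close>

lemma norm_prod_char_remove_le_far:
  assumes "j \<in> I" "0 \<le> s"
  shows "exp (s\<^sup>2 / 2) * (\<Prod>k\<in>I - {j}. cmod (char (\<mu> k) s)) \<le> exp (2 * const_a * lyapunov * s ^ 3) / const_l"
proof -
  define w where "w = sqrt (v j)"
  have w: "0 \<le> w" "v j = w\<^sup>2" "w ^ 3 \<le> \<beta> j"
    using v_nonneg[OF assms(1)] sqrt_v_cube_le[OF assms(1)] by (auto simp: w_def)
  define z where "z = - (w * s)\<^sup>2 / 2 + 2 * const_a * (w * s) ^ 3"
  have "2 * const_a * s ^ 3 * w ^ 3 \<le> 2 * const_a * s ^ 3 * \<beta> j"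
    using assms w const_a_pos by (intro mult_left_mono) auto
  then have "v j * s\<^sup>2 / 2 + 2 * const_a * s ^ 3 * (lyapunov - \<beta> j) \<le> 2 * const_a * lyapunov * s ^ 3 - z"
    by (simp add: z_def w(2) power_mult_distrib algebra_simps)
  then have "exp (v j * s\<^sup>2 / 2 + 2 * const_a * s ^ 3 * (lyapunov - \<beta> j)) \<le> exp (2 * const_a * lyapunov * s ^ 3) / exp z"
    by (simp flip: exp_diff)
  also have "\<dots> \<le> exp (2 * const_a * lyapunov * s ^ 3) / const_l"
    using const_l_pos const_l_le[of "w * s"] w(1) assms(2) unfolding z_def by (intro divide_left_mono) auto
  finally show ?thesis using norm_prod_char_remove_le[OF assms] by linarith
qed

lemma norm_F_diff_normal_le_crude:
  "cmod (F t - of_real (exp (- t\<^sup>2 / 2)))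
    \<le> lyapunov * exp (- t\<^sup>2 / 2) * integral {0..\<bar>t\<bar>} (\<lambda>s. s\<^sup>2 / 2 * exp (s\<^sup>2 / 2))"
proof (intro norm_F_diff_normal_le norm_G_diff_le)
  fix s j assume "j \<in> I"
  have "(\<Prod>k\<in>I - {j}. cmod (char (\<mu> k) s)) \<le> 1"
    using norm_char_le_1 by (intro prod_le_1) auto
  then show "exp (s\<^sup>2 / 2) * (\<Prod>k\<in>I - {j}. cmod (char (\<mu> k) s)) \<le> exp (s\<^sup>2 / 2)"
    by (simp add: mult_left_le)
qed (auto intro!: continuous_intros)

text \<open>In terms of the cube root \<open>e\<close> of \<open>lyapunov\<close>, \<open>A\<close>
  is the endpoint \<open>1 / (6 * const_a * e)\<close> of the near estimate; beyond it the far
  estimate takes over.\<close>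

lemma norm_F_diff_normal_le_refined:
  defines "A \<equiv> lyapunov powr (- 1 / 3) / (6 * const_a)"
  shows "cmod (F t - of_real (exp (- t\<^sup>2 / 2))) \<le>
    (if \<bar>t\<bar> \<le> A then
       lyapunov * exp (- t\<^sup>2 / 2) * integral {0..\<bar>t\<bar>} (\<lambda>s. s\<^sup>2 / 2 * exp (s\<^sup>2 * lyapunov powr (2 / 3) / 2))
     else
       lyapunov * exp (- t\<^sup>2 / 2) *
         (integral {0..A} (\<lambda>s. s\<^sup>2 / 2 * exp (s\<^sup>2 * lyapunov powr (2 / 3) / 2)) +
          integral {A..\<bar>t\<bar>} (\<lambda>s. s\<^sup>2 / (2 * const_l) * exp (2 * const_a * lyapunov * s ^ 3))))"
proof -
  define e where "e = lyapunov powr (1 / 3)"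
  have e: "0 < e" "lyapunov = e ^ 3" "lyapunov powr (2 / 3) = e\<^sup>2" "A = 1 / (6 * const_a * e)"
  proof -
    show "0 < e" using lyapunov_pos by (simp add: e_def)
    have "e powr 3 = lyapunov" "e powr 2 = lyapunov powr (2 / 3)"
      unfolding e_def powr_powr using lyapunov_pos by simp_all
    then show "lyapunov = e ^ 3" "lyapunov powr (2 / 3) = e\<^sup>2"
      using \<open>0 < e\<close> by simp_all
    have "lyapunov powr (- 1 / 3) = 1 / e"
      using powr_minus_divide[of lyapunov "1 / 3"] by (simp add: e_def)
    then show "A = 1 / (6 * const_a * e)" by (simp add: A_def)
  qed
  have "0 \<le> A" using e(1) const_a_pos by (simp add: e(4))
  have near: "cmod (G w - G 0) \<le> lyapunov * integral {0..w} (\<lambda>s. s\<^sup>2 / 2 * exp (s\<^sup>2 * lyapunov powr (2 / 3) / 2))"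
    if "0 \<le> w" "w \<le> A" for w
    using that e norm_prod_char_remove_le_near[OF _ _ e(1,2)]
    by (intro norm_G_diff_le) (auto intro!: continuous_intros)
  have far: "cmod (G w - G A) \<le> lyapunov * integral {A..w} (\<lambda>s. s\<^sup>2 / 2 * (exp (2 * const_a * lyapunov * s ^ 3) / const_l))"
    if "A \<le> w" for w
    using that \<open>0 \<le> A\<close> const_l_pos by (intro norm_G_diff_le norm_prod_char_remove_le_far) (auto intro!: continuous_intros)
  show ?thesis
  proof (cases "\<bar>t\<bar> \<le> A")
    case True
    then show ?thesis using norm_F_diff_normal_le[OF near[of "\<bar>t\<bar>"]] by simp
  next
    case False
    \<comment> \<open>The increment of \<open>G\<close> is split at \<open>A\<close>, and each piece
      uses its own uniform bound.\<close>
    have "cmod (G \<bar>t\<bar> - G 0) \<le> cmod (G \<bar>t\<bar> - G A) + cmod (G A - G 0)"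
      by (metis diff_add_cancel add_diff_eq norm_triangle_ineq)
    also have "\<dots> \<le> lyapunov * (integral {0..A} (\<lambda>s. s\<^sup>2 / 2 * exp (s\<^sup>2 * lyapunov powr (2 / 3) / 2)) +
          integral {A..\<bar>t\<bar>} (\<lambda>s. s\<^sup>2 / (2 * const_l) * exp (2 * const_a * lyapunov * s ^ 3)))"
      using near[of A] far[of "\<bar>t\<bar>"] False \<open>0 \<le> A\<close> by (simp add: distrib_left)
    finally show ?thesis using norm_F_diff_normal_le False by simp
  qed
qed

end

section \<open>Transfer to independent random variables\<close>

lemma (in prob_space) centered_third_moment_distr:
  fixes Y :: "'a \<Rightarrow> real"
  assumes "random_variable borel Y" "integrable M (\<lambda>\<omega>. \<bar>Y \<omega>\<bar> ^ 3)" "expectation Y = 0"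
  shows "centered_third_moment (distr M borel Y)"
    and "centered_third_moment.var (distr M borel Y) = expectation (\<lambda>\<omega>. (Y \<omega>)\<^sup>2)"
    and "centered_third_moment.abs3 (distr M borel Y) = expectation (\<lambda>\<omega>. \<bar>Y \<omega>\<bar> ^ 3)"
proof -
  have 1: "real_distribution (distr M borel Y)" using assms(1) by simp
  show 2: "centered_third_moment (distr M borel Y)"
    unfolding centered_third_moment_def centered_third_moment_axioms_def
    using assms 1 by (simp add: integrable_distr_eq integral_distr)
  show "centered_third_moment.var (distr M borel Y) = expectation (\<lambda>\<omega>. (Y \<omega>)\<^sup>2)"
    using assms(1) by (simp add: centered_third_moment.var_def[OF 2] integral_distr)
  show "centered_third_moment.abs3 (distr M borel Y) = expectation (\<lambda>\<omega>. \<bar>Y \<omega>\<bar> ^ 3)"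
    using assms(1) by (simp add: centered_third_moment.abs3_def[OF 2] integral_distr)
qed

theorem theorem5:
  fixes \<Omega> :: "'a measure" and X :: "nat \<Rightarrow> 'a \<Rightarrow> real" and n :: nat
    and \<sigma> \<epsilon> A :: real and S :: "'a \<Rightarrow> real" and f :: "real \<Rightarrow> complex"
    and \<phi> \<delta> :: "real \<Rightarrow> real"
  assumes "prob_space \<Omega>"
    and "prob_space.indep_vars \<Omega> (\<lambda>_. borel) X {1..n}"
    and "\<And>j. j \<in> {1..n} \<Longrightarrow> integrable \<Omega> (\<lambda>\<omega>. \<bar>X j \<omega>\<bar> ^ 3)"
    and "\<And>j. j \<in> {1..n} \<Longrightarrow> prob_space.expectation \<Omega> (X j) = 0"
    and "(\<Sum>j=1..n. prob_space.variance \<Omega> (X j)) > 0"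
  defines "\<sigma> \<equiv> sqrt (\<Sum>j=1..n. prob_space.variance \<Omega> (X j))"
    and "S \<equiv> (\<lambda>\<omega>. (\<Sum>j=1..n. X j \<omega>) / \<sigma>)"
    and "\<epsilon> \<equiv> (\<Sum>j=1..n. prob_space.expectation \<Omega> (\<lambda>\<omega>. \<bar>X j \<omega>\<bar> ^ 3)) / \<sigma> ^ 3"
    and "f \<equiv> char (distr \<Omega> borel S)"
    and "\<phi> \<equiv> (\<lambda>t. exp (- t\<^sup>2 / 2))"
    and "\<delta> \<equiv> (\<lambda>t. cmod (f t - complex_of_real (\<phi> t)))"
    and "A \<equiv> \<epsilon> powr (- 1 / 3) / (6 * const_a)"
  shows "(\<forall>t. cmod (f t) \<le> exp (b_fun t (2 * \<epsilon>) / 2)) \<and>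
    (\<forall>t. \<delta> t \<le> \<epsilon> * \<phi> t * integral {0..\<bar>t\<bar>} (\<lambda>s. s\<^sup>2 / 2 * exp (s\<^sup>2 / 2))) \<and>
    (\<forall>t. \<delta> t \<le>
      (if \<bar>t\<bar> \<le> A then
         \<epsilon> * \<phi> t * integral {0..\<bar>t\<bar>} (\<lambda>s. s\<^sup>2 / 2 * exp (s\<^sup>2 * \<epsilon> powr (2 / 3) / 2))
       else
         \<epsilon> * \<phi> t *
           (integral {0..A} (\<lambda>s. s\<^sup>2 / 2 * exp (s\<^sup>2 * \<epsilon> powr (2 / 3) / 2)) +
            integral {A..\<bar>t\<bar>} (\<lambda>s. s\<^sup>2 / (2 * const_l) * exp (2 * const_a * \<epsilon> * s ^ 3)))))"
proof -
  interpret prob_space \<Omega> by fact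
  \<comment> \<open>Division by \<sigma> makes the variances sum to one and turns
    \<open>lyapunov\<close> into \<epsilon>.\<close>
  define Y where "Y = (\<lambda>j \<omega>. X j \<omega> / \<sigma>)"
  define \<mu> where "\<mu> = (\<lambda>j. distr \<Omega> borel (Y j))"
  have \<sigma>: "0 < \<sigma>" "\<sigma>\<^sup>2 = (\<Sum>j=1..n. variance (X j))" using assms(5) by (auto simp: \<sigma>_def)
  have rv: "random_variable borel (X j)" if "j \<in> {1..n}" for j
    using assms(2) that by (auto simp: indep_vars_def)
  have Y: "random_variable borel (Y j)" "integrable \<Omega> (\<lambda>\<omega>. \<bar>Y j \<omega>\<bar> ^ 3)" "expectation (Y j) = 0"
    "expectation (\<lambda>\<omega>. \<bar>Y j \<omega>\<bar> ^ 3) = expectation (\<lambda>\<omega>. \<bar>X j \<omega>\<bar> ^ 3) / \<sigma> ^ 3"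
    "expectation (\<lambda>\<omega>. (Y j \<omega>)\<^sup>2) = variance (X j) / \<sigma>\<^sup>2" if "j \<in> {1..n}" for j
    using rv[OF that] assms(3,4)[OF that] \<sigma>(1)
    by (simp_all add: Y_def power_divide)
  have distr: "centered_third_moment (\<mu> j)"
    "centered_third_moment.var (\<mu> j) = variance (X j) / \<sigma>\<^sup>2"
    "centered_third_moment.abs3 (\<mu> j) = expectation (\<lambda>\<omega>. \<bar>X j \<omega>\<bar> ^ 3) / \<sigma> ^ 3" if "j \<in> {1..n}" for j
    using centered_third_moment_distr[OF Y(1-3)[OF that]] Y(4,5)[OF that] by (simp_all add: \<mu>_def)
  interpret normalized_third_moments "{1..n}" \<mu>
  proof (rule normalized_third_moments.intro)
    have "(\<Sum>j=1..n. centered_third_moment.var (\<mu> j)) = (\<Sum>j=1..n. variance (X j) / \<sigma>\<^sup>2)"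
      using distr(2) by (rule sum.cong[OF refl])
    then show "(\<Sum>j=1..n. centered_third_moment.var (\<mu> j)) = 1"
      using \<sigma> assms(5) by (simp add: sum_divide_distrib[symmetric])
  qed (simp_all only: distr finite_atLeastAtMost)
  have \<epsilon>: "\<epsilon> = lyapunov"
    unfolding \<epsilon>_def lyapunov_def \<beta>_def by (simp only: distr(3) sum_divide_distrib cong: sum.cong)
  have indep: "indep_vars (\<lambda>_. borel) Y {1..n}"
    unfolding Y_def by (rule indep_vars_compose2[OF assms(2)]) simp
  have S: "S = (\<lambda>\<omega>. \<Sum>j=1..n. Y j \<omega>)"
    by (simp add: S_def Y_def sum_divide_distrib)
  \<comment> \<open>Independence enters here: the characteristic function of the sum is the product
    of those of the summands.\<close>
  have f: "f = F"
  proof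
    show "f t = F t" for t
      unfolding f_def S F_def unfolding \<mu>_def by (rule char_distr_sum[OF indep])
  qed
  show ?thesis
    unfolding \<delta>_def \<phi>_def A_def f \<epsilon>
    by (intro conjI allI norm_F_le norm_F_diff_normal_le_crude norm_F_diff_normal_le_refined)
qed

end
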